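(* Let $n>1$ and $p,q\in\mathbb{N}\cup\{0\}$. Let $f_{p,q}(z)=\sum_{|\alpha|=p,|\beta|=q}a_{\alpha\bar\beta}z^\alpha\bar z^\beta$ be a polynomial on $\mathbb{C}^n$, not identically zero, that is harmonic in the unit ball $B_n$, and let $u\in C^2(B_n)$ satisfy $\tilde\Delta u=0$ in $B_n$ and $u=f_{p,q}$ on $\partial B_n$, where $$\tilde\Delta=\sum_{j,k=1}^n\left(\delta_{jk}-|z|^2z_j\bar z_k\right)\frac{\partial^2}{\partial z_j\partial\bar z_k}.$$ (i) If $n$ is odd and $u\in C^{\frac{n+1}{2}}(\overline{B_n})$, then $pq=0$. (ii) If $n$ is even and $u\in C^{\frac n2,\alpha}(\overline{B_n})$ for some $\alpha>1/2$, then $pq=0$.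
   Context: Multi-index notation: $z^\alpha=z_1^{\alpha_1}\cdots z_n^{\alpha_n}$, $|\alpha|=\alpha_1+\dots+\alpha_n$. *)

theory Defs
  imports "HOL-Analysis.Analysis"
begin

(* Points of C^n are modelled as complex ^ 'n, n = CARD('n). Derivatives are real
   (Frechet) derivatives, C^n being viewed as R^{2n}. *)

definition pd :: "'a::real_normed_vector \<Rightarrow> ('a \<Rightarrow> 'b::real_normed_vector) \<Rightarrow> 'a \<Rightarrow> 'b" where
  "pd v f x = frechet_derivative f (at x) v"

fun iter_pd :: "'a::real_normed_vector list \<Rightarrow> ('a \<Rightarrow> 'b::real_normed_vector) \<Rightarrow> 'a \<Rightarrow> 'b" where
  "iter_pd [] f = f"
| "iter_pd (v # vs) f = pd v (iter_pd vs f)"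

definition Ck_on :: "nat \<Rightarrow> 'a::euclidean_space set \<Rightarrow> ('a \<Rightarrow> 'b::real_normed_vector) \<Rightarrow> bool" where
  "Ck_on k U f \<longleftrightarrow>
     (\<forall>ds. length ds \<le> k \<longrightarrow> set ds \<subseteq> Basis \<longrightarrow>
        continuous_on U (iter_pd ds f) \<and>
        (length ds < k \<longrightarrow> (\<forall>x\<in>U. iter_pd ds f differentiable (at x))))"

definition Ck_closure :: "nat \<Rightarrow> 'a::euclidean_space set \<Rightarrow> ('a \<Rightarrow> 'b::real_normed_vector) \<Rightarrow> bool" where
  "Ck_closure k U f \<longleftrightarrow> Ck_on k U f \<and>
     (\<forall>ds. length ds \<le> k \<longrightarrow> set ds \<subseteq> Basis \<longrightarrow>
        (\<exists>g. continuous_on (closure U) g \<and> (\<forall>x\<in>U. g x = iter_pd ds f x)))"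

definition Ck_holder :: "nat \<Rightarrow> real \<Rightarrow> 'a::euclidean_space set \<Rightarrow> ('a \<Rightarrow> 'b::real_normed_vector) \<Rightarrow> bool" where
  "Ck_holder k a U f \<longleftrightarrow> Ck_closure k U f \<and>
     (\<forall>ds. length ds = k \<longrightarrow> set ds \<subseteq> Basis \<longrightarrow>
        (\<exists>C. \<forall>x\<in>U. \<forall>y\<in>U. norm (iter_pd ds f x - iter_pd ds f y) \<le> C * dist x y powr a))"

definition dz :: "'n::finite \<Rightarrow> (complex ^ 'n \<Rightarrow> complex) \<Rightarrow> complex ^ 'n \<Rightarrow> complex" where
  "dz j f x = (pd (axis j 1) f x - \<i> * pd (axis j \<i>) f x) / 2"

definition dzbar :: "'n::finite \<Rightarrow> (complex ^ 'n \<Rightarrow> complex) \<Rightarrow> complex ^ 'n \<Rightarrow> complex" where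
  "dzbar j f x = (pd (axis j 1) f x + \<i> * pd (axis j \<i>) f x) / 2"

definition inv_lap :: "(complex ^ 'n::finite \<Rightarrow> complex) \<Rightarrow> complex ^ 'n \<Rightarrow> complex" where
  "inv_lap u z = (\<Sum>j\<in>UNIV. \<Sum>k\<in>UNIV.
      ((if j = k then 1 else 0) - of_real ((norm z)\<^sup>2) * z $ j * cnj (z $ k)) * dz j (dzbar k u) z)"

definition lap :: "(complex ^ 'n::finite \<Rightarrow> complex) \<Rightarrow> complex ^ 'n \<Rightarrow> complex" where
  "lap f z = (\<Sum>b\<in>Basis. pd b (pd b f) z)"

definition bihom_poly :: "nat \<Rightarrow> nat \<Rightarrow> (('n::finite \<Rightarrow> nat) \<Rightarrow> ('n \<Rightarrow> nat) \<Rightarrow> complex) \<Rightarrow> complex ^ 'n \<Rightarrow> complex" where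
  "bihom_poly p q a z = (\<Sum>\<alpha>\<in>{\<alpha>. sum \<alpha> UNIV = p}. \<Sum>\<beta>\<in>{\<beta>. sum \<beta> UNIV = q}.
      a \<alpha> \<beta> * (\<Prod>j\<in>UNIV. (z $ j) ^ \<alpha> j) * (\<Prod>j\<in>UNIV. (cnj (z $ j)) ^ \<beta> j))"

end

theory Submission
  imports Defs
begin

text \<open>The radial ansatz \<open>u = g(|z|\<^sup>4) f\<close> turns the equation into a hypergeometric one, so that
  \<open>v = f(z) F(|z|\<^sup>4) / F(1)\<close> with \<open>F = 2F1(p/2, q/2; (1+n+p+q)/2)\<close> solves the Dirichlet problem, and
  \<open>u = v\<close> by the maximum principle. Here \<open>c - a - b = (n+1)/2\<close>, and for \<open>pq > 0\<close> the Taylor coefficients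
  of \<open>F\<close> are positive and comparable to \<open>k\<close> to the power \<open>-(n+3)/2\<close>. Along a ray \<open>t \<zeta>\<close> with
  \<open>f(\<zeta>) \<noteq> 0\<close>, the derivative of order \<open>(n+1)/2\<close> (\<open>n\<close> odd) therefore diverges logarithmically as
  \<open>t\<close> tends to 1, and the one of order \<open>n/2\<close> (\<open>n\<close> even) has modulus of continuity no better than
  \<open>(1-t)\<close> to the power \<open>1/2\<close>.\<close>

section \<open>Symmetry of second derivatives\<close>

text \<open>The coefficient matrix of \<open>inv_lap\<close> is I - |z|^2 z z*, with eigenvalue 1 -
  |z|^4 in the direction z. It degenerates exactly on the sphere, which is why polynomial boundary
  data need not give a smooth solution: the loss of smoothness is governed by the second indicial
  exponent c - a - b of the hypergeometric equation at 1. For pq = 0 the series F reduces to the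
  constant 1, u = f, and the obstruction disappears. Two points shape the proof. Uniqueness is
  argued at interior points only, where the matrix is positive definite and the operator is a sum of
  pure real second derivatives; this rewriting needs mixed partials to commute. The singularity at t
  = 1 is found without connection formulas: as all coefficients are nonnegative, any finite part of
  the series of a derivative is dominated by the whole, and letting t tend to 1 turns bounds on the
  function into bounds on the coefficients.\<close>

lemma pd_eqI:
  assumes "(f has_derivative f') (at x)"
  shows "pd v f x = f' v"
  unfolding pd_def using frechet_derivative_at[OF assms] by simp

lemma has_derivative_pd:
  assumes "f differentiable (at x)"
  shows "(f has_derivative (\<lambda>v. pd v f x)) (at x)"
  unfolding pd_def using assms frechet_derivative_works[of f "at x"] by simp

text \<open>Valid even at points of non-differentiability: \<open>frechet_derivative\<close> is a
  choice from the predicate \<open>has_derivative\<close>, and near \<open>x\<close> both functions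
  satisfy that predicate for the same linear maps, so the choices coincide.\<close>

lemma pd_cong:
  assumes "open U" "x \<in> U" "\<And>y. y \<in> U \<Longrightarrow> f y = g y"
  shows "pd v f x = pd v g x"
proof -
  have "(f has_derivative f') (at x) \<longleftrightarrow> (g has_derivative f') (at x)" for f'
    using has_derivative_transform_within_open[OF _ assms(1,2)] assms(3) by metis
  then show ?thesis
    unfolding pd_def frechet_derivative_def by simp
qed

lemma differentiable_cong_open:
  assumes "open U" "x \<in> U" "\<And>y. y \<in> U \<Longrightarrow> g y = f y" "f differentiable (at x)"
  shows "g differentiable (at x)"
  using has_derivative_transform_within_open[OF _ assms(1,2)] assms(3,4) unfolding differentiable_def by metis

lemma pd_bounded_linear:
  assumes "bounded_linear T" "f differentiable (at x)"
  shows "pd v (\<lambda>y. T (f y)) x = T (pd v f x)"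
  by (rule pd_eqI[OF bounded_linear.has_derivative[OF assms(1) has_derivative_pd[OF assms(2)]]])

lemma differentiable_bounded_linear:
  assumes "bounded_linear T" "f differentiable (at x)"
  shows "(\<lambda>y. T (f y)) differentiable (at x)"
  using bounded_linear.has_derivative[OF assms(1) has_derivative_pd[OF assms(2)]]
  unfolding differentiable_def by blast

lemma has_vector_derivative_along_line:
  assumes "f differentiable (at (x + t *\<^sub>R v))"
  shows "((\<lambda>s. f (x + s *\<^sub>R v)) has_vector_derivative pd v f (x + t *\<^sub>R v)) (at t)"
proof -
  have "((\<lambda>s. x + s *\<^sub>R v) has_derivative (\<lambda>s. s *\<^sub>R v)) (at t)"
    by (auto intro!: derivative_eq_intros)
  from has_derivative_compose[OF this has_derivative_pd[OF assms]]
  have "((\<lambda>s. f (x + s *\<^sub>R v)) has_derivative (\<lambda>s. pd (s *\<^sub>R v) f (x + t *\<^sub>R v))) (at t)" .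
  moreover have "pd (s *\<^sub>R v) f (x + t *\<^sub>R v) = s *\<^sub>R pd v f (x + t *\<^sub>R v)" for s
    using linear_cmul[OF bounded_linear.linear[OF has_derivative_bounded_linear[OF has_derivative_pd[OF assms]]]]
    by simp
  ultimately show ?thesis
    by (simp add: has_vector_derivative_def)
qed

text \<open>The mean value theorem is used once, in direction \<open>a\<close>; differentiability of
  \<open>pd a f\<close> at the single point \<open>x\<close> then expands both remaining values to
  first order. The second difference is symmetric in \<open>a\<close> and \<open>b\<close>, so
  exchanging their roles yields Young's form of the symmetry theorem.\<close>

lemma second_difference_quotient:
  fixes f :: "'a::real_normed_vector \<Rightarrow> real"
  assumes U: "open U" "x \<in> U" and f: "\<And>y. y \<in> U \<Longrightarrow> f differentiable (at y)"
    and pa: "pd a f differentiable (at x)"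
  shows "((\<lambda>h. (f (x + h *\<^sub>R a + h *\<^sub>R b) - f (x + h *\<^sub>R a) - f (x + h *\<^sub>R b) + f x) / h\<^sup>2)
           \<longlongrightarrow> pd b (pd a f) x) (at_right 0)"
proof (rule tendstoI)
  fix e :: real assume e: "e > 0"
  define D where "D = (\<lambda>v. pd v (pd a f) x)"
  have D: "(pd a f has_derivative D) (at x)"
    unfolding D_def by (rule has_derivative_pd[OF pa])
  then interpret D: bounded_linear D by (rule has_derivative_bounded_linear)
  \<comment> \<open>\<open>h * M\<close> dominates the sum of the distances from \<open>x\<close> of
    the two points produced by the mean value theorem; the summand 1 keeps \<open>M\<close> positive
    when \<open>a\<close> and \<open>b\<close> vanish.\<close>
  define M where "M = 2 * norm a + norm b + 1"
  have M: "M > 0" unfolding M_def by (smt (verit) norm_ge_zero)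
  have "e / (2 * M) > 0" using e M by simp
  then obtain d where d: "d > 0"
    "\<And>y. norm (y - x) < d \<Longrightarrow> norm (pd a f y - pd a f x - D (y - x)) \<le> e / (2 * M) * norm (y - x)"
    using D unfolding has_derivative_at_alt by blast
  obtain r where r: "r > 0" "ball x r \<subseteq> U" using U open_contains_ball by blast
  define h0 where "h0 = min d r / M"
  have h0: "h0 > 0" unfolding h0_def using d r M by simp
  have "dist ((f (x + h *\<^sub>R a + h *\<^sub>R b) - f (x + h *\<^sub>R a) - f (x + h *\<^sub>R b) + f x) / h\<^sup>2) (D b) < e"
    if h: "0 < h" "h < h0" for h
  proof -
    have hM: "h * M < min d r" using h M unfolding h0_def by (simp add: pos_less_divide_eq)
    have small: "norm (s *\<^sub>R a + t *\<^sub>R b) \<le> h * (norm a + norm b)" "norm (s *\<^sub>R a + t *\<^sub>R b) < min d r"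
      if "0 \<le> s" "s \<le> h" "0 \<le> t" "t \<le> h" for s t
    proof -
      have "norm (s *\<^sub>R a + t *\<^sub>R b) \<le> s * norm a + t * norm b"
        using norm_triangle_ineq[of "s *\<^sub>R a" "t *\<^sub>R b"] that by simp
      also have "\<dots> \<le> h * norm a + h * norm b"
        using that by (intro add_mono mult_right_mono) auto
      finally show 1: "norm (s *\<^sub>R a + t *\<^sub>R b) \<le> h * (norm a + norm b)" by (simp add: algebra_simps)
      have "h * (norm a + norm b) \<le> h * M" using h unfolding M_def by (intro mult_left_mono) auto
      then show "norm (s *\<^sub>R a + t *\<^sub>R b) < min d r" using 1 hM by linarith
    qed
    have inU: "x + s *\<^sub>R a + t *\<^sub>R b \<in> U" if "0 \<le> s" "s \<le> h" "0 \<le> t" "t \<le> h" for s t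

    proof -
      have "x + (s *\<^sub>R a + t *\<^sub>R b) \<in> ball x r"
        using small(2)[OF that] by (simp add: dist_norm norm_minus_commute[of x] del: minus_add_distrib)
      then show ?thesis using r(2) by (auto simp: add.assoc)
    qed
    \<comment> \<open>Increment in direction \<open>b\<close> as a function of the step in direction
      \<open>a\<close>; the second difference is \<open>\<psi> h - \<psi> 0\<close>.\<close>
    define \<psi> where "\<psi> = (\<lambda>s. f ((x + h *\<^sub>R b) + s *\<^sub>R a) - f (x + s *\<^sub>R a))"
    have der: "(\<psi> has_real_derivative
          (pd a f ((x + h *\<^sub>R b) + s *\<^sub>R a) - pd a f (x + s *\<^sub>R a))) (at s)" if "0 \<le> s" "s \<le> h" for s
      unfolding \<psi>_def has_real_derivative_iff_has_vector_derivative
      using inU[OF that, of h] inU[OF that, of 0] h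
      by (intro has_vector_derivative_diff has_vector_derivative_along_line f) (simp_all add: ac_simps)
    obtain s where s: "0 < s" "s < h"
      "\<psi> h - \<psi> 0 = (h - 0) * (pd a f ((x + h *\<^sub>R b) + s *\<^sub>R a) - pd a f (x + s *\<^sub>R a))"
      using MVT2[OF h(1) der] by blast
    let ?y1 = "x + h *\<^sub>R b + s *\<^sub>R a" and ?y2 = "x + s *\<^sub>R a"
    have y: "?y1 - x = s *\<^sub>R a + h *\<^sub>R b" "?y2 - x = s *\<^sub>R a + 0 *\<^sub>R b" by simp_all
    have "norm (?y1 - x) < d" "norm (?y2 - x) < d"
      unfolding y using small(2)[of s h] small(2)[of s 0] s h by simp_all
    note d(2)[OF this(1)] d(2)[OF this(2)]
    moreover have "norm (p - q) \<le> c * (u + v)" if "norm p \<le> c * u" "norm q \<le> c * v" for p q c u v :: real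
      using norm_triangle_ineq4[of p q] that unfolding distrib_left by linarith
    moreover have "pd a f ?y1 - pd a f ?y2 - (D (?y1 - x) - D (?y2 - x)) =
      (pd a f ?y1 - pd a f x - D (?y1 - x)) - (pd a f ?y2 - pd a f x - D (?y2 - x))" by simp
    ultimately have "norm (pd a f ?y1 - pd a f ?y2 - (D (?y1 - x) - D (?y2 - x)))
      \<le> e / (2 * M) * (norm (?y1 - x) + norm (?y2 - x))"
      by metis
    also have "D (?y1 - x) - D (?y2 - x) = h * D b"
      unfolding D.diff[symmetric] by (simp add: D.scaleR)
    also have "norm (?y1 - x) + norm (?y2 - x) \<le> h * (norm a + norm b) + h * norm a"
      using small(1)[of s h] s h unfolding y by (intro add_mono) (simp_all add: mult_right_mono)
    also have "\<dots> \<le> h * M" using h unfolding M_def by (simp add: algebra_simps)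
    finally have "norm (pd a f ?y1 - pd a f ?y2 - h * D b) \<le> e / (2 * M) * (h * M)"
      using e M by (simp add: mult_left_mono divide_right_mono)
    then have *: "\<bar>pd a f ?y1 - pd a f ?y2 - h * D b\<bar> \<le> h * (e / 2)"
      using M by (simp add: mult.commute)
    have "f (x + h *\<^sub>R a + h *\<^sub>R b) - f (x + h *\<^sub>R a) - f (x + h *\<^sub>R b) + f x = \<psi> h - \<psi> 0"
      unfolding \<psi>_def by (simp add: ac_simps)
    also have "\<dots> = h * (pd a f ?y1 - pd a f ?y2)" using s(3) by simp
    finally have "(f (x + h *\<^sub>R a + h *\<^sub>R b) - f (x + h *\<^sub>R a) - f (x + h *\<^sub>R b) + f x) / h\<^sup>2 - D b
      = h * (pd a f ?y1 - pd a f ?y2) / h\<^sup>2 - D b"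
      by (rule arg_cong)
    also have "\<dots> = (pd a f ?y1 - pd a f ?y2 - h * D b) / h"
      using h(1) by (simp add: diff_divide_distrib power2_eq_square)
    also have "\<bar>\<dots>\<bar> \<le> e / 2" using * h(1) by (simp add: field_simps)
    finally show ?thesis using e by (simp add: dist_real_def)
  qed
  then show "\<forall>\<^sub>F h in at_right 0. dist ((f (x + h *\<^sub>R a + h *\<^sub>R b) - f (x + h *\<^sub>R a)
      - f (x + h *\<^sub>R b) + f x) / h\<^sup>2) (pd b (pd a f) x) < e"
    unfolding eventually_at_right_field D_def using h0 by blast
qed

lemma pd_commute_real:
  fixes f :: "'a::real_normed_vector \<Rightarrow> real"
  assumes "open U" "x \<in> U" "\<And>y. y \<in> U \<Longrightarrow> f differentiable (at y)"
    and "pd a f differentiable (at x)" "pd b f differentiable (at x)"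
  shows "pd a (pd b f) x = pd b (pd a f) x"
proof (rule tendsto_unique[OF trivial_limit_at_right_real])
  show "((\<lambda>h. (f (x + h *\<^sub>R a + h *\<^sub>R b) - f (x + h *\<^sub>R a) - f (x + h *\<^sub>R b) + f x) / h\<^sup>2)
           \<longlongrightarrow> pd b (pd a f) x) (at_right 0)"
    using assms by (intro second_difference_quotient)
  have "((\<lambda>h. (f (x + h *\<^sub>R b + h *\<^sub>R a) - f (x + h *\<^sub>R b) - f (x + h *\<^sub>R a) + f x) / h\<^sup>2)
           \<longlongrightarrow> pd a (pd b f) x) (at_right 0)"
    using assms by (intro second_difference_quotient)
  then show "((\<lambda>h. (f (x + h *\<^sub>R a + h *\<^sub>R b) - f (x + h *\<^sub>R a) - f (x + h *\<^sub>R b) + f x) / h\<^sup>2)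
           \<longlongrightarrow> pd a (pd b f) x) (at_right 0)"
    by (simp add: algebra_simps)
qed

text \<open>The mean value theorem is confined to real values, so the real case is applied to the
  real and imaginary parts, which commute with \<open>pd\<close> as bounded linear maps.\<close>

lemma pd_commute:
  fixes f :: "'a::real_normed_vector \<Rightarrow> complex"
  assumes U: "open U" "x \<in> U" and f: "\<And>y. y \<in> U \<Longrightarrow> f differentiable (at y)"
    and ab: "pd a f differentiable (at x)" "pd b f differentiable (at x)"
  shows "pd a (pd b f) x = pd b (pd a f) x"
proof -
  have *: "T (pd a (pd b f) x) = T (pd b (pd a f) x)" if T: "bounded_linear T"
    for T :: "complex \<Rightarrow> real"
  proof -
    have 1: "pd v (\<lambda>y. T (f y)) y = T (pd v f y)" if "y \<in> U" for v y
      using pd_bounded_linear[OF T f[OF that]] .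
    have 2: "pd w (pd v (\<lambda>y. T (f y))) x = T (pd w (pd v f) x)"
      if "pd v f differentiable (at x)" for v w
      using pd_cong[OF U 1] pd_bounded_linear[OF T that] by simp
    have 3: "pd v (\<lambda>y. T (f y)) differentiable (at x)" if "pd v f differentiable (at x)" for v
      by (rule differentiable_cong_open[OF U 1 differentiable_bounded_linear[OF T that]])
    show ?thesis
      unfolding 2[OF ab(1), symmetric] 2[OF ab(2), symmetric]
      using pd_commute_real[OF U, of "\<lambda>y. T (f y)" a b] differentiable_bounded_linear[OF T f] 3 ab
      by blast
  qed
  show ?thesis
    using *[OF bounded_linear_Re] *[OF bounded_linear_Im] by (simp add: complex_eq_iff)
qed

section \<open>Wirtinger derivatives\<close>

text \<open>The real differential expanded in dz_j and its conjugates. Both coefficient families are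
  carried together because conjugation exchanges them.\<close>

definition has_wirtinger ::
  "(complex ^ 'n::finite \<Rightarrow> complex) \<Rightarrow> ('n \<Rightarrow> complex) \<Rightarrow> ('n \<Rightarrow> complex) \<Rightarrow> complex ^ 'n \<Rightarrow> bool" where
  "has_wirtinger f A B z \<longleftrightarrow>
     (f has_derivative (\<lambda>h. \<Sum>j\<in>UNIV. A j * h $ j + B j * cnj (h $ j))) (at z)"

lemma has_wirtinger_differentiable: "has_wirtinger f A B z \<Longrightarrow> f differentiable (at z)"
  unfolding has_wirtinger_def differentiable_def by blast

lemma has_wirtinger_pd:
  "has_wirtinger f A B z \<Longrightarrow> pd v f z = (\<Sum>j\<in>UNIV. A j * v $ j + B j * cnj (v $ j))"
  unfolding has_wirtinger_def by (rule pd_eqI)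

lemma has_wirtinger_pd_axis:
  assumes "has_wirtinger f A B z"
  shows "pd (axis j c) f z = A j * c + B j * cnj c"
proof -
  have "A i * axis j c $ i + B i * cnj (axis j c $ i) = (if i = j then A j * c + B j * cnj c else 0)" for i
    by (simp add: axis_def)
  then show ?thesis unfolding has_wirtinger_pd[OF assms] by simp
qed

lemma has_wirtinger_dz: "has_wirtinger f A B z \<Longrightarrow> dz j f z = A j"
  and has_wirtinger_dzbar: "has_wirtinger f A B z \<Longrightarrow> dzbar j f z = B j"
  by (simp_all add: dz_def dzbar_def has_wirtinger_pd_axis algebra_simps)

lemma pd_axis_1: "pd (axis j 1) f = (\<lambda>z. dz j f z + dzbar j f z)"
  and pd_axis_ii: "pd (axis j \<i>) f = (\<lambda>z. \<i> * (dz j f z - dzbar j f z))"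
  by (auto simp: dz_def dzbar_def fun_eq_iff field_simps)

lemma has_wirtingerI:
  assumes "f differentiable (at z)"
  shows "has_wirtinger f (\<lambda>j. dz j f z) (\<lambda>j. dzbar j f z) z"
proof -
  have lin: "linear (\<lambda>v. pd v f z)"
    using has_derivative_linear[OF has_derivative_pd[OF assms]] .
  have "pd h f z = (\<Sum>j\<in>UNIV. dz j f z * h $ j + dzbar j f z * cnj (h $ j))" for h
  proof -
    have "h = (\<Sum>j\<in>UNIV. Re (h $ j) *\<^sub>R axis j 1 + Im (h $ j) *\<^sub>R axis j \<i>)"
      by (simp add: vec_eq_iff sum.distrib axis_def if_distrib[of "\<lambda>x. _ * x"] if_distrib[of "\<lambda>x. _ *\<^sub>R x"]
          complex_eq_iff cong: if_cong)
    then have "pd h f z = pd (\<Sum>j\<in>UNIV. Re (h $ j) *\<^sub>R axis j 1 + Im (h $ j) *\<^sub>R axis j \<i>) f z"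
      by simp
    also have "\<dots> = (\<Sum>j\<in>UNIV. Re (h $ j) *\<^sub>R pd (axis j 1) f z + Im (h $ j) *\<^sub>R pd (axis j \<i>) f z)"
      by (simp add: linear_sum[OF lin] linear_add[OF lin] linear_cmul[OF lin])
    also have "\<dots> = (\<Sum>j\<in>UNIV. dz j f z * h $ j + dzbar j f z * cnj (h $ j))"
      unfolding pd_axis_1 pd_axis_ii
      by (intro sum.cong refl) (simp add: complex_eq_iff algebra_simps)
    finally show ?thesis .
  qed
  then show ?thesis
    using has_derivative_pd[OF assms] unfolding has_wirtinger_def by simp
qed

lemma dz_cong:
  assumes "open U" "x \<in> U" "\<And>y. y \<in> U \<Longrightarrow> f y = g y"
  shows "dz j f x = dz j g x" "dzbar j f x = dzbar j g x"
  using pd_cong[OF assms] by (simp_all add: dz_def dzbar_def)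

lemma has_wirtinger_const: "has_wirtinger (\<lambda>_. c) (\<lambda>_. 0) (\<lambda>_. 0) z"
  unfolding has_wirtinger_def by simp

lemma has_wirtinger_add:
  assumes "has_wirtinger f A B z" "has_wirtinger g A' B' z"
  shows "has_wirtinger (\<lambda>z. f z + g z) (\<lambda>j. A j + A' j) (\<lambda>j. B j + B' j) z"
  using has_derivative_add[OF assms[unfolded has_wirtinger_def]]
  unfolding has_wirtinger_def by (simp add: sum.distrib[symmetric] algebra_simps)

lemma has_wirtinger_mult:
  assumes "has_wirtinger f A B z" "has_wirtinger g A' B' z"
  shows "has_wirtinger (\<lambda>z. f z * g z) (\<lambda>j. f z * A' j + A j * g z) (\<lambda>j. f z * B' j + B j * g z) z"
  unfolding has_wirtinger_def
  by (rule has_derivative_eq_rhs[OF has_derivative_mult[OF assms[unfolded has_wirtinger_def]]], rule ext,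
      unfold sum_distrib_left sum_distrib_right sum.distrib[symmetric],
      intro sum.cong refl, simp add: algebra_simps)

lemma has_wirtinger_cmult:
  "has_wirtinger f A B z \<Longrightarrow> has_wirtinger (\<lambda>z. c * f z) (\<lambda>j. c * A j) (\<lambda>j. c * B j) z"
  using has_wirtinger_mult[OF has_wirtinger_const[of c], of f A B z] by simp

lemma has_wirtinger_sum:
  assumes "\<And>i. i \<in> I \<Longrightarrow> has_wirtinger (f i) (A i) (B i) z"
  shows "has_wirtinger (\<lambda>z. \<Sum>i\<in>I. f i z) (\<lambda>j. \<Sum>i\<in>I. A i j) (\<lambda>j. \<Sum>i\<in>I. B i j) z"
  using assms
  by (induction I rule: infinite_finite_induct) (auto intro!: has_wirtinger_const has_wirtinger_add)

lemma has_wirtinger_coord: "has_wirtinger (\<lambda>z. z $ i) (\<lambda>j. if j = i then 1 else 0) (\<lambda>_. 0) z"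
proof -
  have "((\<lambda>z. z $ i) has_derivative (\<lambda>h. h $ i)) (at z)"
    by (rule bounded_linear.has_derivative[OF bounded_linear_vec_nth has_derivative_ident])
  then show ?thesis unfolding has_wirtinger_def by (simp add: if_distrib[of "\<lambda>x. x * _"] cong: if_cong)
qed

lemma has_wirtinger_cnj:
  assumes "has_wirtinger f A B z"
  shows "has_wirtinger (\<lambda>z. cnj (f z)) (\<lambda>j. cnj (B j)) (\<lambda>j. cnj (A j)) z"
  using bounded_linear.has_derivative[OF bounded_linear_cnj assms[unfolded has_wirtinger_def]]
  unfolding has_wirtinger_def by (simp add: add.commute)

text \<open>Since |z|^2 is the sum of \<open>z $ j * cnj (z $ j)\<close>, its derivative in z_j is
  \<open>cnj (z $ j)\<close> and its derivative in the conjugate variable is \<open>z $ j\<close>;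
  the rest is the chain rule.\<close>

lemma has_wirtinger_radial:
  assumes "(\<phi> has_real_derivative d) (at ((norm z)\<^sup>2))"
  shows "has_wirtinger (\<lambda>z. of_real (\<phi> ((norm z)\<^sup>2)))
           (\<lambda>j. of_real d * cnj (z $ j)) (\<lambda>j. of_real d * z $ j) z"
proof -
  have "((\<lambda>z. (norm z)\<^sup>2) has_derivative (\<lambda>h. 2 * (z \<bullet> h))) (at z)"
    unfolding power2_norm_eq_inner
    by (auto intro!: derivative_eq_intros simp: inner_commute)
  from has_derivative_compose[OF this assms[unfolded has_field_derivative_def]]
  have "((\<lambda>z. complex_of_real (\<phi> ((norm z)\<^sup>2))) has_derivative (\<lambda>h. of_real (d * (2 * (z \<bullet> h))))) (at z)"
    by (rule bounded_linear.has_derivative[OF bounded_linear_of_real])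
  moreover have "complex_of_real (d * (2 * (z \<bullet> h))) =
     (\<Sum>j\<in>UNIV. of_real d * cnj (z $ j) * h $ j + of_real d * z $ j * cnj (h $ j))" for h
  proof -
    have "complex_of_real (d * (2 * (z \<bullet> h))) = (\<Sum>j\<in>UNIV. of_real (d * (2 * (z $ j \<bullet> h $ j))))"
      by (simp add: inner_vec_def sum_distrib_left)
    also have "\<dots> = (\<Sum>j\<in>UNIV. of_real d * cnj (z $ j) * h $ j + of_real d * z $ j * cnj (h $ j))"
      by (intro sum.cong refl) (simp add: complex_eq_iff inner_complex_def algebra_simps)
    finally show ?thesis .
  qed
  ultimately show ?thesis unfolding has_wirtinger_def by simp
qed

text \<open>Tailored to what \<open>dz_dzbar_commute\<close> uses and to what the product rule
  delivers for the explicit solution: the first Wirtinger derivatives are themselves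
  differentiable.\<close>

definition twice_differentiable_on :: "(complex ^ 'n::finite \<Rightarrow> complex) \<Rightarrow> (complex ^ 'n) set \<Rightarrow> bool" where
  "twice_differentiable_on f U \<longleftrightarrow> (\<forall>z\<in>U. f differentiable (at z) \<and>
     (\<forall>j. dz j f differentiable (at z) \<and> dzbar j f differentiable (at z)))"

lemma Basis_cvec_eq: "(Basis :: (complex ^ 'n::finite) set) = (\<lambda>j. axis j 1) ` UNIV \<union> (\<lambda>j. axis j \<i>) ` UNIV"
  unfolding Basis_vec_def Basis_complex_def by auto

lemma sum_Basis_cvec:
  fixes g :: "complex ^ 'n::finite \<Rightarrow> 'b::comm_monoid_add"
  shows "sum g Basis = (\<Sum>j\<in>UNIV. g (axis j 1) + g (axis j \<i>))"
proof -
  have "inj (\<lambda>j::'n. axis j (1::complex))" "inj (\<lambda>j::'n. axis j \<i>)"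
    by (auto simp: inj_def axis_eq_axis)
  moreover have "(\<lambda>j::'n. axis j (1::complex)) ` UNIV \<inter> (\<lambda>j. axis j \<i>) ` UNIV = {}"
    by (auto simp: axis_eq_axis complex_eq_iff)
  ultimately show ?thesis
    unfolding Basis_cvec_eq by (simp add: sum.union_disjoint sum.reindex sum.distrib)
qed

lemma Ck_on_2_twice_differentiable:
  assumes "Ck_on 2 U (f :: complex ^ 'n::finite \<Rightarrow> complex)"
  shows "twice_differentiable_on f U"
proof -
  have 1: "f differentiable (at z)" if "z \<in> U" for z
    using assms that unfolding Ck_on_def by (auto dest: spec[of _ "[]"])
  have "pd b f differentiable (at z)" if "z \<in> U" "b \<in> Basis" for z b
    using assms that unfolding Ck_on_def by (auto dest: spec[of _ "[b]"])
  then have 2: "pd (axis j 1) f differentiable (at z)" "pd (axis j \<i>) f differentiable (at z)"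
    if "z \<in> U" for z j
    using that unfolding Basis_cvec_eq by blast+
  have "(\<lambda>x. (pd (axis j 1) f x - \<i> * pd (axis j \<i>) f x) / 2) differentiable (at z)"
    "(\<lambda>x. (pd (axis j 1) f x + \<i> * pd (axis j \<i>) f x) / 2) differentiable (at z)" if "z \<in> U" for z j
    using 2[OF that] by (auto intro!: derivative_intros)
  then show ?thesis
    using 1 unfolding twice_differentiable_on_def dz_def[abs_def] dzbar_def[abs_def] by blast
qed

lemma twice_differentiable_pd_axis:
  assumes "twice_differentiable_on f U" "z \<in> U"
  shows "pd (axis j 1) f differentiable (at z)" "pd (axis j \<i>) f differentiable (at z)"
  using assms unfolding pd_axis_1 pd_axis_ii twice_differentiable_on_def
  by (auto intro!: derivative_intros)

lemma dz_add_scaled: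
  assumes "f differentiable (at z)" "g differentiable (at z)"
  shows "dz j (\<lambda>z. f z + c * g z) z = dz j f z + c * dz j g z"
    "dzbar j (\<lambda>z. f z + c * g z) z = dzbar j f z + c * dzbar j g z"
  using has_wirtinger_add[OF has_wirtingerI[OF assms(1)] has_wirtinger_cmult[OF has_wirtingerI[OF assms(2)]], of c]
  by (rule has_wirtinger_dz, rule has_wirtinger_dzbar)

lemma dz_dzbar_commute:
  assumes f: "twice_differentiable_on f U" and U: "open U" "z \<in> U"
  shows "dzbar k (dz j f) z = dz j (dzbar k f) z"
proof -
  have d: "f differentiable (at y)" if "y \<in> U" for y
    using f that unfolding twice_differentiable_on_def by blast
  have d2: "pd (axis i c) f differentiable (at z)" if "c = 1 \<or> c = \<i>" for i c
    using twice_differentiable_pd_axis[OF f U(2)] that by blast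
  have comm: "pd (axis k c) (pd (axis j d) f) z = pd (axis j d) (pd (axis k c) f) z"
    if "c = 1 \<or> c = \<i>" "d = 1 \<or> d = \<i>" for c d
    by (rule pd_commute[OF U d d2[OF that(1)] d2[OF that(2)]])
  have A: "dz j f = (\<lambda>z. (1/2) * pd (axis j 1) f z + (- \<i>/2) * pd (axis j \<i>) f z)"
    "dzbar k f = (\<lambda>z. (1/2) * pd (axis k 1) f z + (\<i>/2) * pd (axis k \<i>) f z)"
    by (auto simp: fun_eq_iff dz_def dzbar_def field_simps)
  have L: "pd v (\<lambda>z. c * g z + c' * h z) z = c * pd v g z + c' * pd v h z"
    if "g differentiable (at z)" "h differentiable (at z)" for v c c' and g h :: "complex ^ 'a \<Rightarrow> complex"
    using that by (intro pd_eqI has_derivative_add has_derivative_mult_right has_derivative_pd)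
  have pd1: "pd v (dz j f) z = (1/2) * pd v (pd (axis j 1) f) z + (- \<i>/2) * pd v (pd (axis j \<i>) f) z"
    and pd2: "pd v (dzbar k f) z = (1/2) * pd v (pd (axis k 1) f) z + (\<i>/2) * pd v (pd (axis k \<i>) f) z" for v
    unfolding A using d2 by (simp_all only: L simp_thms)
  show ?thesis
    unfolding dzbar_def[of k "dz j f"] dz_def[of j "dzbar k f"] pd1 pd2
    by (simp add: comm algebra_simps)
qed

lemma lap_eq_sum_dz_dzbar:
  assumes f: "twice_differentiable_on f U" and U: "open U" "z \<in> U"
  shows "lap f z = 4 * (\<Sum>j\<in>UNIV. dz j (dzbar j f) z)"
proof -
  have "pd (axis j 1) (pd (axis j 1) f) z + pd (axis j \<i>) (pd (axis j \<i>) f) z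
      = 4 * dz j (dzbar j f) z" for j
  proof -
    have d: "has_wirtinger (dz j f) (\<lambda>k. dz k (dz j f) z) (\<lambda>k. dzbar k (dz j f) z) z"
      "has_wirtinger (dzbar j f) (\<lambda>k. dz k (dzbar j f) z) (\<lambda>k. dzbar k (dzbar j f) z) z"
      using f U unfolding twice_differentiable_on_def by (auto intro!: has_wirtingerI)
    show ?thesis
      unfolding pd_axis_1[of j f] pd_axis_ii[of j f] right_diff_distrib
      using has_wirtinger_pd_axis[OF has_wirtinger_add[OF d], of j 1]
        has_wirtinger_pd_axis[OF has_wirtinger_add[OF has_wirtinger_cmult[OF d(1), of "\<i>"]
          has_wirtinger_cmult[OF d(2), of "-\<i>"]], of j "\<i>"]
        dz_dzbar_commute[OF f U, of j j]
      by (simp add: algebra_simps)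
  qed
  then show ?thesis
    unfolding lap_def sum_Basis_cvec sum_distrib_left by simp
qed

text \<open>Replacing \<xi> by i \<xi> changes the sign of the terms with two holomorphic or two
  antiholomorphic derivatives and preserves the mixed ones, so in the sum the former cancel and the
  latter double. This links the complex operator to real second derivatives, whose sign is known at
  a maximum.\<close>

lemma levi_form_eq:
  fixes \<xi> :: "complex ^ 'n::finite"
  assumes f: "twice_differentiable_on f U" and U: "open U" "z \<in> U"
  shows "pd \<xi> (pd \<xi> f) z + pd (\<i> *s \<xi>) (pd (\<i> *s \<xi>) f) z =
    4 * (\<Sum>j\<in>UNIV. \<Sum>k\<in>UNIV. \<xi> $ j * cnj (\<xi> $ k) * dz j (dzbar k f) z)"
proof -
  have d: "has_wirtinger (dz j f) (\<lambda>k. dz k (dz j f) z) (\<lambda>k. dzbar k (dz j f) z) z"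
    "has_wirtinger (dzbar j f) (\<lambda>k. dz k (dzbar j f) z) (\<lambda>k. dzbar k (dzbar j f) z) z" for j
    using f U unfolding twice_differentiable_on_def by (auto intro!: has_wirtingerI)
  have *: "pd v (pd v f) z = (\<Sum>j\<in>UNIV. \<Sum>k\<in>UNIV.
      v $ j * v $ k * dz k (dz j f) z + v $ j * cnj (v $ k) * dzbar k (dz j f) z
      + (cnj (v $ j) * v $ k * dz k (dzbar j f) z + cnj (v $ j) * cnj (v $ k) * dzbar k (dzbar j f) z))" for v
  proof -
    have "pd v (pd v f) z = pd v (\<lambda>x. \<Sum>j\<in>UNIV. v $ j * dz j f x + cnj (v $ j) * dzbar j f x) z"
      using f U unfolding twice_differentiable_on_def
      by (intro pd_cong[OF U]) (auto simp: has_wirtinger_pd[OF has_wirtingerI] mult.commute)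
    also have "\<dots> = (\<Sum>k\<in>UNIV. (\<Sum>j\<in>UNIV. v $ j * dz k (dz j f) z + cnj (v $ j) * dz k (dzbar j f) z) * v $ k
       + (\<Sum>j\<in>UNIV. v $ j * dzbar k (dz j f) z + cnj (v $ j) * dzbar k (dzbar j f) z) * cnj (v $ k))"
      by (intro has_wirtinger_pd has_wirtinger_sum has_wirtinger_add has_wirtinger_cmult d)
    also have "\<dots> = (\<Sum>k\<in>UNIV. \<Sum>j\<in>UNIV.
      v $ j * v $ k * dz k (dz j f) z + v $ j * cnj (v $ k) * dzbar k (dz j f) z
      + (cnj (v $ j) * v $ k * dz k (dzbar j f) z + cnj (v $ j) * cnj (v $ k) * dzbar k (dzbar j f) z))"
      unfolding sum_distrib_right sum.distrib[symmetric]
      by (intro sum.cong refl) (simp add: algebra_simps)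
    finally show ?thesis by (subst sum.swap)
  qed
  have "pd \<xi> (pd \<xi> f) z + pd (\<i> *s \<xi>) (pd (\<i> *s \<xi>) f) z =
    (\<Sum>j\<in>UNIV. \<Sum>k\<in>UNIV. 2 * (\<xi> $ j * cnj (\<xi> $ k) * dz j (dzbar k f) z)
       + 2 * (\<xi> $ k * cnj (\<xi> $ j) * dz k (dzbar j f) z))"
    unfolding * sum.distrib[symmetric]
    by (intro sum.cong refl) (simp add: dz_dzbar_commute[OF f U] algebra_simps)
  also have "\<dots> = (\<Sum>j\<in>UNIV. \<Sum>k\<in>UNIV. 2 * (\<xi> $ j * cnj (\<xi> $ k) * dz j (dzbar k f) z))
     + (\<Sum>k\<in>UNIV. \<Sum>j\<in>UNIV. 2 * (\<xi> $ k * cnj (\<xi> $ j) * dz k (dzbar j f) z))"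
    unfolding sum.distrib by (subst (2) sum.swap) simp
  also have "\<dots> = 4 * (\<Sum>j\<in>UNIV. \<Sum>k\<in>UNIV. \<xi> $ j * cnj (\<xi> $ k) * dz j (dzbar k f) z)"
    by (simp add: sum_distrib_left[symmetric])
  finally show ?thesis .
qed

section \<open>The maximum principle\<close>

text \<open>If \<open>l\<close> were positive, \<phi>1 would vanish at 0 and be positive just to the
  right of it, and by the mean value theorem \<phi> would exceed its maximum there.\<close>

lemma second_derivative_nonpos_at_max:
  fixes \<phi> :: "real \<Rightarrow> real"
  assumes "d > 0" and \<phi>: "\<And>t. \<bar>t\<bar> < d \<Longrightarrow> (\<phi> has_real_derivative \<phi>1 t) (at t)"
    and l: "(\<phi>1 has_real_derivative l) (at 0)" and max: "\<And>t. \<bar>t\<bar> < d \<Longrightarrow> \<phi> t \<le> \<phi> 0"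
  shows "l \<le> 0"
proof (rule ccontr)
  assume "\<not> l \<le> 0"
  then obtain e where e: "e > 0" "\<And>h. 0 < h \<Longrightarrow> h < e \<Longrightarrow> \<phi>1 0 < \<phi>1 (0 + h)"
    using DERIV_pos_inc_right[OF l] by force
  have "\<phi>1 0 = 0"
    using DERIV_local_max[OF \<phi>[of 0] \<open>d > 0\<close>] max \<open>d > 0\<close> by simp
  define t where "t = min d e / 2"
  have t: "0 < t" "t < d" "t < e" using \<open>d > 0\<close> e(1) unfolding t_def by auto
  obtain s where s: "0 < s" "s < t" "\<phi> t - \<phi> 0 = (t - 0) * \<phi>1 s"
    using MVT2[of 0 t \<phi> \<phi>1] \<phi> t by auto
  have "\<phi>1 s > 0" using e(2)[of s] s t \<open>\<phi>1 0 = 0\<close> by simp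
  then have "\<phi> t > \<phi> 0" using s(3) t by (simp add: algebra_simps)
  then show False using max[of t] t by simp
qed

lemma pd_differentiable:
  assumes f: "twice_differentiable_on f U" and U: "open U" "z \<in> U"
  shows "pd v f differentiable (at z)"
proof (rule differentiable_cong_open[OF U])
  show "pd v f x = (\<Sum>j\<in>UNIV. dz j f x * v $ j + dzbar j f x * cnj (v $ j))" if "x \<in> U" for x
    using f that unfolding twice_differentiable_on_def by (simp add: has_wirtinger_pd[OF has_wirtingerI])
  show "(\<lambda>x. \<Sum>j\<in>UNIV. dz j f x * v $ j + dzbar j f x * cnj (v $ j)) differentiable (at z)"
    using f U(2) unfolding twice_differentiable_on_def by (auto intro!: derivative_intros)
qed

text \<open>Restriction to the line through \<open>z\<close> in direction \<open>v\<close>. The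
  factor \<open>c\<close> selects a real component of \<open>w\<close>;
  \<open>2 * e * (norm v)\<^sup>2\<close> is the second derivative of the term
  \<open>e * (norm x)\<^sup>2\<close> along that line.\<close>

lemma second_pd_at_max:
  fixes w :: "complex ^ 'n::finite \<Rightarrow> complex"
  assumes w: "twice_differentiable_on w U" and U: "open U" "z \<in> U"
    and max: "\<And>x. x \<in> U \<Longrightarrow> Re (c * w x) + e * (norm x)\<^sup>2 \<le> Re (c * w z) + e * (norm z)\<^sup>2"
  shows "Re (c * pd v (pd v w) z) + 2 * e * (norm v)\<^sup>2 \<le> 0"
proof -
  obtain r where r: "r > 0" "ball z r \<subseteq> U" using U open_contains_ball by blast
  define d where "d = r / (norm v + 1)"
  have d: "d > 0" unfolding d_def using r by (simp add: add_nonneg_pos)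
  have inU: "z + t *\<^sub>R v \<in> U" if "\<bar>t\<bar> < d" for t
  proof -
    have "\<bar>t\<bar> * norm v \<le> \<bar>t\<bar> * (norm v + 1)" by (simp add: mult_left_mono)
    also have "\<dots> < r" using that unfolding d_def by (simp add: pos_less_divide_eq add_nonneg_pos)
    finally show ?thesis using r(2) by (auto simp: dist_norm subset_eq)
  qed
  have nsq: "(norm (z + t *\<^sub>R v))\<^sup>2 = (norm z)\<^sup>2 + 2 * t * (z \<bullet> v) + t\<^sup>2 * (norm v)\<^sup>2" for t
    unfolding power2_norm_eq_inner
    by (simp add: inner_simps inner_commute power2_eq_square algebra_simps)
  have blR: "((\<lambda>t. Re (c * g (z + t *\<^sub>R v))) has_real_derivative Re (c * pd v g (z + t *\<^sub>R v))) (at t)"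
    if "g differentiable (at (z + t *\<^sub>R v))" for t and g :: "complex ^ 'n \<Rightarrow> complex"
    unfolding has_real_derivative_iff_has_vector_derivative
    using bounded_linear.has_vector_derivative[OF bounded_linear_Re
        bounded_linear.has_vector_derivative[OF bounded_linear_mult_right has_vector_derivative_along_line[OF that]]] .
  define \<phi> where "\<phi> = (\<lambda>t. Re (c * w (z + t *\<^sub>R v)) + e * ((norm z)\<^sup>2 + 2 * t * (z \<bullet> v) + t\<^sup>2 * (norm v)\<^sup>2))"
  define \<phi>1 where "\<phi>1 = (\<lambda>t. Re (c * pd v w (z + t *\<^sub>R v)) + e * (2 * (z \<bullet> v) + 2 * t * (norm v)\<^sup>2))"
  have 1: "(\<phi> has_real_derivative \<phi>1 t) (at t)" if "\<bar>t\<bar> < d" for t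
  proof -
    have "w differentiable (at (z + t *\<^sub>R v))"
      using w inU[OF that] unfolding twice_differentiable_on_def by blast
    then show ?thesis unfolding \<phi>_def \<phi>1_def
      by (intro DERIV_add blR) (auto intro!: derivative_eq_intros)
  qed
  have 2: "(\<phi>1 has_real_derivative Re (c * pd v (pd v w) (z + 0 *\<^sub>R v)) + e * (2 * (norm v)\<^sup>2)) (at 0)"
    unfolding \<phi>1_def using pd_differentiable[OF w U]
    by (intro DERIV_add blR) (auto intro!: derivative_eq_intros)
  have 3: "\<phi> t \<le> \<phi> 0" if "\<bar>t\<bar> < d" for t
    using max[OF inU[OF that]] unfolding \<phi>_def nsq by simp
  have "Re (c * pd v (pd v w) (z + 0 *\<^sub>R v)) + e * (2 * (norm v)\<^sup>2) \<le> 0"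
    by (rule second_derivative_nonpos_at_max[OF d 1 2 3])
  then show ?thesis by (simp add: mult.left_commute mult.commute)
qed

lemma sum_coord_cnj: "(\<Sum>l\<in>UNIV. z $ l * cnj (z $ l)) = of_real ((norm z)\<^sup>2)"
  for z :: "complex ^ 'n::finite"
  unfolding power2_norm_eq_inner inner_vec_def
  by (simp add: complex_eq_iff inner_complex_def power2_eq_square)

text \<open>With \<open>s = r / (1 + sqrt (1 - r\<^sup>2))\<close>, \<open>r = |z|\<^sup>2\<close>, the coefficient matrix \<open>I - r z z\<^sup>*\<close> is the
  square of the Hermitian matrix \<open>I - s z z\<^sup>*\<close>, whose columns are the vectors \<open>b l\<close> below.\<close>

lemma inv_lap_eq_sum_levi_forms:
  fixes z :: "complex ^ 'n::finite"
  assumes "norm z < 1"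
  obtains b :: "'n \<Rightarrow> complex ^ 'n" where
    "\<And>w. inv_lap w z = (\<Sum>l\<in>UNIV. \<Sum>j\<in>UNIV. \<Sum>k\<in>UNIV. b l $ j * cnj (b l $ k) * dz j (dzbar k w) z)"
    "\<And>l. b l $ l \<noteq> 0"
proof -
  define r where "r = (norm z)\<^sup>2"
  define q where "q = sqrt (1 - r\<^sup>2)"
  define s where "s = r / (1 + q)"
  have r: "0 \<le> r" "r \<le> 1" using assms unfolding r_def by (simp_all add: power_le_one)
  then have q: "0 \<le> q" "q\<^sup>2 = 1 - r\<^sup>2" unfolding q_def by (simp_all add: power_le_one)
  have sq: "s * (1 + q) = r" using q(1) unfolding s_def by simp
  \<comment> \<open>Squaring I - s z z* gives I - (2 s - s^2 r) z z*, because z* z = r; so this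
    coefficient has to equal r.\<close>
  have "(2 * s - s\<^sup>2 * r) * (1 + q)\<^sup>2 = 2 * (s * (1 + q)) * (1 + q) - (s * (1 + q))\<^sup>2 * r"
    by (simp add: power2_eq_square algebra_simps)
  also have "\<dots> = r * (2 * (1 + q) - r\<^sup>2)"
    unfolding sq by (simp add: power2_eq_square algebra_simps)
  also have "2 * (1 + q) - r\<^sup>2 = (1 + q)\<^sup>2" using q(2) by (simp add: power2_eq_square algebra_simps)
  finally have s: "2 * s - s\<^sup>2 * r = r" using q(1) by simp
  define b :: "'n \<Rightarrow> complex ^ 'n" where "b = (\<lambda>l. \<chi> j. (if j = l then 1 else 0) - of_real s * cnj (z $ l) * z $ j)"
  have zz: "(\<Sum>l\<in>UNIV. z $ l * cnj (z $ l)) = of_real r"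
    unfolding r_def by (rule sum_coord_cnj)
  have coef: "(\<Sum>l\<in>UNIV. b l $ j * cnj (b l $ k)) =
      (if j = k then 1 else 0) - of_real ((norm z)\<^sup>2) * z $ j * cnj (z $ k)" for j k
  proof -
    have "b l $ j * cnj (b l $ k) = (if l = j then (if j = k then 1 else 0) - of_real s * z $ j * cnj (z $ k) else 0)
       - (if l = k then of_real s * z $ j * cnj (z $ k) else 0)
       + (of_real (s\<^sup>2) * z $ j * cnj (z $ k)) * (z $ l * cnj (z $ l))" for l
      unfolding b_def by (auto simp: algebra_simps power2_eq_square)
    then have "(\<Sum>l\<in>UNIV. b l $ j * cnj (b l $ k)) = (if j = k then 1 else 0) - of_real s * z $ j * cnj (z $ k)
       - of_real s * z $ j * cnj (z $ k) + (of_real (s\<^sup>2) * z $ j * cnj (z $ k)) * of_real r"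
      unfolding zz[symmetric] by (simp only: sum.distrib sum_subtractf sum_distrib_left[symmetric]) simp
    also have "\<dots> = (if j = k then 1 else 0) - of_real (2 * s - s\<^sup>2 * r) * (z $ j * cnj (z $ k))"
      by (simp add: algebra_simps)
    finally show ?thesis unfolding s by (simp add: r_def mult.assoc)
  qed
  have "inv_lap w z = (\<Sum>l\<in>UNIV. \<Sum>j\<in>UNIV. \<Sum>k\<in>UNIV. b l $ j * cnj (b l $ k) * dz j (dzbar k w) z)" for w
    unfolding inv_lap_def coef[symmetric] sum_distrib_right
    by (subst (2) sum.swap, subst sum.swap) simp
  \<comment> \<open>A zero would mean s |z_l|^2 = 1, although s \<le> r and |z_l|^2 \<le> r with r <
    1. The nonvanishing provides the strict inequality in the maximum principle.\<close>
  moreover have "b l $ l \<noteq> 0" for l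
  proof -
    have "norm z \<ge> 1" if "b l $ l = 0"
    proof -
      have "of_real s * (cnj (z $ l) * z $ l) = 1" using that unfolding b_def by (simp add: mult.assoc)
      then have "s * (norm (z $ l))\<^sup>2 = 1"
        by (metis complex_norm_square mult.commute of_real_eq_1_iff of_real_mult)
      moreover have "s \<le> r" "s \<ge> 0" using r q unfolding s_def by (simp_all add: divide_le_eq distrib_left)
      moreover have "(norm (z $ l))\<^sup>2 \<le> r" unfolding r_def by (simp add: Finite_Cartesian_Product.norm_nth_le power_mono)
      ultimately have "1 \<le> r * r" using r by (metis mult_mono zero_le_power2)
      then have "1 \<le> r" using r mult_left_le[of r r] by linarith
      then show ?thesis unfolding r_def using power2_le_imp_le[of 1 "norm z"] by simp
    qed
    then show ?thesis using assms by auto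
  qed
  ultimately show ?thesis using that by blast
qed

text \<open>A positive value of \<open>Re (c * w)\<close> would survive a small strictly convex
  perturbation and give an interior maximum. There every real second derivative of
  \<open>Re (c * w)\<close> along a nonzero vector is strictly negative, hence so is the sum of Levi
  forms representing the operator, which contradicts \<open>inv_lap w = 0\<close>.\<close>

lemma inv_lap_maximum_principle:
  fixes w :: "complex ^ 'n::finite \<Rightarrow> complex"
  assumes w: "twice_differentiable_on w (ball 0 1)" and cont: "continuous_on (cball 0 1) w"
    and lap: "\<And>z. z \<in> ball 0 1 \<Longrightarrow> inv_lap w z = 0" and bdry: "\<And>z. z \<in> sphere 0 1 \<Longrightarrow> w z = 0"
    and z: "z \<in> ball 0 1"
  shows "Re (c * w z) \<le> 0"
proof (rule ccontr)
  assume "\<not> Re (c * w z) \<le> 0"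
  \<comment> \<open>With half of the supposed value, \<phi> is at least \<open>2 * e\<close> at
    \<open>z\<close> but equals \<open>e\<close> on the sphere, where \<open>w\<close> vanishes; so
    the maximum lies inside.\<close>
  define e where "e = Re (c * w z) / 2"
  have e: "e > 0" using \<open>\<not> Re (c * w z) \<le> 0\<close> unfolding e_def by simp
  define \<phi> where "\<phi> = (\<lambda>x. Re (c * w x) + e * (norm x)\<^sup>2)"
  have "continuous_on (cball 0 1) \<phi>" unfolding \<phi>_def by (intro continuous_intros cont)
  then obtain y where y: "y \<in> cball 0 1" "\<And>x. x \<in> cball 0 1 \<Longrightarrow> \<phi> x \<le> \<phi> y"
    using continuous_attains_sup[OF compact_cball] by (metis cball_eq_empty linorder_not_less zero_le_one)
  have "\<phi> z = 2 * e + e * (norm z)\<^sup>2" unfolding \<phi>_def e_def by simp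
  moreover have "0 \<le> e * (norm z)\<^sup>2" using e by simp
  ultimately have "e < \<phi> z" using e by linarith
  then have "e < \<phi> y" using y(2)[of z] z by simp
  then have "norm y \<noteq> 1" using bdry[of y] unfolding \<phi>_def by auto
  then have yb: "y \<in> ball 0 1" "norm y < 1" using y(1) by auto
  have le: "Re (c * pd v (pd v w) y) + 2 * e * (norm v)\<^sup>2 \<le> 0" for v
    using second_pd_at_max[OF w open_ball yb(1)] y(2) unfolding \<phi>_def by auto
  obtain b where b: "\<And>w. inv_lap w y = (\<Sum>l\<in>UNIV. \<Sum>j\<in>UNIV. \<Sum>k\<in>UNIV. b l $ j * cnj (b l $ k) * dz j (dzbar k w) y)"
    "\<And>l. b l $ l \<noteq> 0"
    by (rule inv_lap_eq_sum_levi_forms[OF yb(2)]) blast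
  have lev: "4 * inv_lap w y = (\<Sum>l\<in>UNIV. pd (b l) (pd (b l) w) y + pd (\<i> *s b l) (pd (\<i> *s b l) w) y)"
    by (simp only: b(1) levi_form_eq[OF w open_ball yb(1)] sum_distrib_left)
  have "Re (c * (4 * inv_lap w y)) = (\<Sum>l\<in>UNIV. Re (c * pd (b l) (pd (b l) w) y)
      + Re (c * pd (\<i> *s b l) (pd (\<i> *s b l) w) y))"
    unfolding lev by (simp add: sum_distrib_left distrib_left del: times_complex.sel)
  also have "\<dots> < (\<Sum>l\<in>(UNIV::'n set). 0)"
  proof (rule sum_strict_mono)
    fix l
    have "b l \<noteq> 0" using b(2)[of l] by (metis zero_index)
    then have "0 < 2 * e * (norm (b l))\<^sup>2" using e by simp
    moreover have "0 \<le> 2 * e * (norm (\<i> *s b l))\<^sup>2" using e by simp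
    ultimately show "Re (c * pd (b l) (pd (b l) w) y) + Re (c * pd (\<i> *s b l) (pd (\<i> *s b l) w) y) < 0"
      using le[of "b l"] le[of "\<i> *s b l"] by linarith
  qed simp_all
  finally show False using lap[OF yb(1)] by simp
qed

lemma inv_lap_uniqueness:
  fixes w :: "complex ^ 'n::finite \<Rightarrow> complex"
  assumes w: "twice_differentiable_on w (ball 0 1)" and cont: "continuous_on (cball 0 1) w"
    and lap: "\<And>z. z \<in> ball 0 1 \<Longrightarrow> inv_lap w z = 0" and bdry: "\<And>z. z \<in> sphere 0 1 \<Longrightarrow> w z = 0"
    and z: "z \<in> ball 0 1"
  shows "w z = 0"
proof -
  \<comment> \<open>The multiplier may depend on the point: \<open>cnj (w z)\<close> turns the
    one-sided bound into |w z|^2 \<le> 0.\<close>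
  have "Re (cnj (w z) * w z) \<le> 0"
    using inv_lap_maximum_principle[OF assms] .
  also have "cnj (w z) * w z = of_real ((norm (w z))\<^sup>2)"
    unfolding complex_norm_square by (rule mult.commute)
  finally show ?thesis by simp
qed

section \<open>Radial multiples of bihomogeneous harmonic polynomials\<close>

definition cmonom :: "('n::finite \<Rightarrow> nat) \<Rightarrow> complex ^ 'n \<Rightarrow> complex" where
  "cmonom \<alpha> z = (\<Prod>j\<in>UNIV. (z $ j) ^ \<alpha> j)"

text \<open>The formal derivative of the monomial in z_k. Truncated subtraction is harmless: for
  \<open>\<alpha> k = 0\<close> the leading factor is 0.\<close>

definition dcmonom :: "'n::finite \<Rightarrow> ('n \<Rightarrow> nat) \<Rightarrow> complex ^ 'n \<Rightarrow> complex" where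
  "dcmonom k \<alpha> z = of_nat (\<alpha> k) * cmonom (\<alpha>(k := \<alpha> k - 1)) z"

lemma cmonom_fun_upd: "cmonom (\<alpha>(k := m)) z = (z $ k) ^ m * (\<Prod>j\<in>UNIV - {k}. (z $ j) ^ \<alpha> j)"
proof -
  have "cmonom (\<alpha>(k := m)) z = (z $ k) ^ m * (\<Prod>j\<in>UNIV - {k}. (z $ j) ^ (\<alpha>(k := m)) j)"
    unfolding cmonom_def by (subst prod.remove[of _ k]) auto
  also have "(\<Prod>j\<in>UNIV - {k}. (z $ j) ^ (\<alpha>(k := m)) j) = (\<Prod>j\<in>UNIV - {k}. (z $ j) ^ \<alpha> j)"
    by (intro prod.cong) auto
  finally show ?thesis .
qed

lemma coord_times_dcmonom: "z $ k * dcmonom k \<alpha> z = of_nat (\<alpha> k) * cmonom \<alpha> z"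
proof (cases "\<alpha> k")
  case (Suc m)
  have "cmonom \<alpha> z = (z $ k) ^ \<alpha> k * (\<Prod>j\<in>UNIV - {k}. (z $ j) ^ \<alpha> j)"
    using cmonom_fun_upd[of \<alpha> k "\<alpha> k" z] by simp
  then show ?thesis unfolding dcmonom_def cmonom_fun_upd using Suc by simp
qed (simp add: dcmonom_def)

lemma sum_coord_dcmonom: "(\<Sum>k\<in>UNIV. z $ k * dcmonom k \<alpha> z) = of_nat (sum \<alpha> UNIV) * cmonom \<alpha> z"
  unfolding coord_times_dcmonom by (simp add: sum_distrib_right)

lemma has_wirtinger_cmonom: "has_wirtinger (cmonom \<alpha>) (\<lambda>k. dcmonom k \<alpha> z) (\<lambda>_. 0) z"
proof -
  have "((\<lambda>z. \<Prod>j\<in>UNIV. (z $ j) ^ \<alpha> j) has_derivative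
      (\<lambda>h. \<Sum>i\<in>UNIV. (of_nat (\<alpha> i) * (h $ i) * (z $ i) ^ (\<alpha> i - 1)) * (\<Prod>j\<in>UNIV - {i}. (z $ j) ^ \<alpha> j))) (at z)"
    by (intro has_derivative_prod has_derivative_power
        bounded_linear.has_derivative[OF bounded_linear_vec_nth has_derivative_ident])
  moreover have eq: "(of_nat (\<alpha> i) * (h $ i) * (z $ i) ^ (\<alpha> i - 1)) * (\<Prod>j\<in>UNIV - {i}. (z $ j) ^ \<alpha> j)
      = dcmonom i \<alpha> z * h $ i + 0 * cnj (h $ i)" for i and h :: "complex ^ 'a"
    unfolding dcmonom_def cmonom_fun_upd by simp
  ultimately show ?thesis unfolding has_wirtinger_def cmonom_def[abs_def] by (simp only: eq)
qed

lemma has_wirtinger_dcmonom: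
  "has_wirtinger (dcmonom k \<alpha>) (\<lambda>j. of_nat (\<alpha> k) * dcmonom j (\<alpha>(k := \<alpha> k - 1)) z) (\<lambda>_. 0) z"
  using has_wirtinger_cmult[OF has_wirtinger_cmonom, of "of_nat (\<alpha> k)" "\<alpha>(k := \<alpha> k - 1)" z]
  unfolding dcmonom_def[abs_def] by simp

lemma finite_multi_indices: "finite {\<alpha> :: 'n::finite \<Rightarrow> nat. sum \<alpha> UNIV = p}"
proof (rule finite_subset)
  show "{\<alpha> :: 'n \<Rightarrow> nat. sum \<alpha> UNIV = p} \<subseteq> PiE UNIV (\<lambda>_. {..p})"
  proof
    fix \<alpha> :: "'n \<Rightarrow> nat" assume \<alpha>: "\<alpha> \<in> {\<alpha>. sum \<alpha> UNIV = p}"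
    have "\<alpha> i \<le> p" for i using member_le_sum[of i UNIV \<alpha>] \<alpha> by simp
    then show "\<alpha> \<in> PiE UNIV (\<lambda>_. {..p})" by (simp add: PiE_iff)
  qed
  show "finite (PiE (UNIV :: 'n set) (\<lambda>_. {..p}))" by (intro finite_PiE) auto
qed

context
  fixes p q :: nat and a :: "('n::finite \<Rightarrow> nat) \<Rightarrow> ('n \<Rightarrow> nat) \<Rightarrow> complex"
begin

abbreviation bisum :: "(('n \<Rightarrow> nat) \<Rightarrow> ('n \<Rightarrow> nat) \<Rightarrow> complex) \<Rightarrow> complex" where
  "bisum g \<equiv> \<Sum>\<alpha>\<in>{\<alpha>. sum \<alpha> UNIV = p}. \<Sum>\<beta>\<in>{\<beta>. sum \<beta> UNIV = q}. a \<alpha> \<beta> * g \<alpha> \<beta>"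

lemma bihom_poly_altdef: "bihom_poly p q a = (\<lambda>z. bisum (\<lambda>\<alpha> \<beta>. cmonom \<alpha> z * cnj (cmonom \<beta> z)))"
  unfolding bihom_poly_def[abs_def] cmonom_def by (simp add: mult.assoc)

lemma has_wirtinger_bisum:
  assumes "\<And>\<alpha> \<beta>. has_wirtinger (g \<alpha> \<beta>) (A \<alpha> \<beta>) (B \<alpha> \<beta>) z"
  shows "has_wirtinger (\<lambda>z. bisum (\<lambda>\<alpha> \<beta>. g \<alpha> \<beta> z)) (\<lambda>j. bisum (\<lambda>\<alpha> \<beta>. A \<alpha> \<beta> j)) (\<lambda>j. bisum (\<lambda>\<alpha> \<beta>. B \<alpha> \<beta> j)) z"
  by (intro has_wirtinger_sum has_wirtinger_cmult assms)

lemma has_wirtinger_bihom_poly: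
  "has_wirtinger (bihom_poly p q a) (\<lambda>j. bisum (\<lambda>\<alpha> \<beta>. dcmonom j \<alpha> z * cnj (cmonom \<beta> z)))
     (\<lambda>j. bisum (\<lambda>\<alpha> \<beta>. cmonom \<alpha> z * cnj (dcmonom j \<beta> z))) z"
  unfolding bihom_poly_altdef
  using has_wirtinger_mult[OF has_wirtinger_cmonom has_wirtinger_cnj[OF has_wirtinger_cmonom]]
  by (intro has_wirtinger_bisum) simp

lemma dz_bihom_poly: "dz j (bihom_poly p q a) = (\<lambda>z. bisum (\<lambda>\<alpha> \<beta>. dcmonom j \<alpha> z * cnj (cmonom \<beta> z)))"
  and dzbar_bihom_poly: "dzbar j (bihom_poly p q a) = (\<lambda>z. bisum (\<lambda>\<alpha> \<beta>. cmonom \<alpha> z * cnj (dcmonom j \<beta> z)))"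
  using has_wirtinger_dz[OF has_wirtinger_bihom_poly] has_wirtinger_dzbar[OF has_wirtinger_bihom_poly]
  by blast+

lemma has_wirtinger_dzbar_bihom_poly:
  "\<exists>B. has_wirtinger (dzbar k (bihom_poly p q a)) (\<lambda>j. bisum (\<lambda>\<alpha> \<beta>. dcmonom j \<alpha> z * cnj (dcmonom k \<beta> z))) B z"
proof -
  have "has_wirtinger (\<lambda>z. cmonom \<alpha> z * cnj (dcmonom k \<beta> z)) (\<lambda>j. dcmonom j \<alpha> z * cnj (dcmonom k \<beta> z))
     (\<lambda>j. cmonom \<alpha> z * cnj (of_nat (\<beta> k) * dcmonom j (\<beta>(k := \<beta> k - 1)) z)) z" for \<alpha> \<beta>
    using has_wirtinger_mult[OF has_wirtinger_cmonom has_wirtinger_cnj[OF has_wirtinger_dcmonom]] by simp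
  from has_wirtinger_bisum[of "\<lambda>\<alpha> \<beta> z. cmonom \<alpha> z * cnj (dcmonom k \<beta> z)", OF this]
  show ?thesis unfolding dzbar_bihom_poly by blast
qed

lemma dz_dzbar_bihom_poly:
  "dz j (dzbar k (bihom_poly p q a)) z = bisum (\<lambda>\<alpha> \<beta>. dcmonom j \<alpha> z * cnj (dcmonom k \<beta> z))"
  using has_wirtinger_dzbar_bihom_poly has_wirtinger_dz by blast

lemma twice_differentiable_bihom_poly: "twice_differentiable_on (bihom_poly p q a) U"
proof -
  have "dcmonom j \<alpha> differentiable (at z)" for j and \<alpha> :: "'n \<Rightarrow> nat" and z
    using has_wirtinger_dcmonom has_wirtinger_differentiable by blast
  moreover have "(\<lambda>z. cnj (cmonom \<alpha> z)) differentiable (at z)" for \<alpha> :: "'n \<Rightarrow> nat" and z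
    using has_wirtinger_cnj[OF has_wirtinger_cmonom] has_wirtinger_differentiable by blast
  ultimately have "dz j (bihom_poly p q a) differentiable (at z)" for j z
    unfolding dz_bihom_poly by (auto intro!: derivative_intros simp: finite_multi_indices)
  then show ?thesis
    using has_wirtinger_differentiable has_wirtinger_bihom_poly has_wirtinger_dzbar_bihom_poly
    unfolding twice_differentiable_on_def by blast
qed

lemma sum_bisum: "(\<Sum>i\<in>I. bisum (g i)) = bisum (\<lambda>\<alpha> \<beta>. \<Sum>i\<in>I. g i \<alpha> \<beta>)"
  unfolding sum_distrib_left by (subst sum.swap, intro sum.cong refl, subst sum.swap, rule refl)

lemma mult_bisum: "c * bisum g = bisum (\<lambda>\<alpha> \<beta>. c * g \<alpha> \<beta>)"
  unfolding sum_distrib_left by (simp add: mult.left_commute)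

text \<open>Euler's identity for each monomial, of degree p in z. With the two lemmas that follow,
  it makes f an eigenfunction of the operators that arise when a radial factor is
  differentiated.\<close>

lemma euler_dz: "(\<Sum>j\<in>UNIV. z $ j * dz j (bihom_poly p q a) z) = of_nat p * bihom_poly p q a z"
proof -
  have "(\<Sum>j\<in>UNIV. z $ j * (dcmonom j \<alpha> z * cnj (cmonom \<beta> z))) = of_nat (sum \<alpha> UNIV) * (cmonom \<alpha> z * cnj (cmonom \<beta> z))"
    for \<alpha> \<beta> :: "'n \<Rightarrow> nat"
    by (simp only: mult.assoc[symmetric] sum_distrib_right[symmetric] sum_coord_dcmonom)
  then show ?thesis
    unfolding dz_bihom_poly unfolding bihom_poly_altdef mult_bisum sum_bisum
    by (intro sum.cong refl) auto
qed

lemma euler_dzbar: "(\<Sum>j\<in>UNIV. cnj (z $ j) * dzbar j (bihom_poly p q a) z) = of_nat q * bihom_poly p q a z"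
proof -
  have "(\<Sum>j\<in>UNIV. cnj (z $ j) * (cmonom \<alpha> z * cnj (dcmonom j \<beta> z))) = of_nat (sum \<beta> UNIV) * (cmonom \<alpha> z * cnj (cmonom \<beta> z))"
    for \<alpha> \<beta> :: "'n \<Rightarrow> nat"
  proof -
    have "(\<Sum>j\<in>UNIV. cnj (z $ j) * (cmonom \<alpha> z * cnj (dcmonom j \<beta> z))) = cmonom \<alpha> z * cnj (\<Sum>j\<in>UNIV. z $ j * dcmonom j \<beta> z)"
      by (simp add: sum_distrib_left mult.left_commute)
    then show ?thesis unfolding sum_coord_dcmonom by simp
  qed
  then show ?thesis
    unfolding dzbar_bihom_poly unfolding bihom_poly_altdef mult_bisum sum_bisum
    by (intro sum.cong refl) auto
qed

text \<open>For each monomial the double sum factors into a holomorphic and an antiholomorphic Euler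
  sum. The two derivatives hit different factors, so the eigenvalue is p q without lower-order
  correction.\<close>

lemma euler_dz_dzbar:
  "(\<Sum>j\<in>UNIV. \<Sum>k\<in>UNIV. z $ j * cnj (z $ k) * dz j (dzbar k (bihom_poly p q a)) z)
     = of_nat (p * q) * bihom_poly p q a z"
proof -
  have "(\<Sum>j\<in>UNIV. \<Sum>k\<in>UNIV. z $ j * cnj (z $ k) * (dcmonom j \<alpha> z * cnj (dcmonom k \<beta> z)))
      = of_nat (sum \<alpha> UNIV * sum \<beta> UNIV) * (cmonom \<alpha> z * cnj (cmonom \<beta> z))"
    for \<alpha> \<beta> :: "'n \<Rightarrow> nat"
  proof -
    have "(\<Sum>j\<in>UNIV. \<Sum>k\<in>UNIV. z $ j * cnj (z $ k) * (dcmonom j \<alpha> z * cnj (dcmonom k \<beta> z)))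
      = (\<Sum>j\<in>UNIV. z $ j * dcmonom j \<alpha> z) * cnj (\<Sum>k\<in>UNIV. z $ k * dcmonom k \<beta> z)"
      by (simp add: sum_product ac_simps)
    then show ?thesis unfolding sum_coord_dcmonom by simp
  qed
  then show ?thesis
    unfolding dz_dzbar_bihom_poly unfolding bihom_poly_altdef mult_bisum sum_bisum
    by (intro sum.cong refl) auto
qed

lemma bihom_poly_scaleR: "bihom_poly p q a (t *\<^sub>R z) = of_real (t ^ (p + q)) * bihom_poly p q a z"
proof -
  have "cmonom \<alpha> (t *\<^sub>R z) = of_real (t ^ sum \<alpha> UNIV) * cmonom \<alpha> z" for \<alpha> :: "'n \<Rightarrow> nat"
    unfolding cmonom_def vector_scaleR_component unfolding scaleR_conv_of_real
    by (simp add: power_mult_distrib prod.distrib power_sum)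
  then show ?thesis
    unfolding bihom_poly_altdef mult_bisum
    by (intro sum.cong refl) (auto simp: power_add)
qed

end

section \<open>The invariant operator on radial multiples of f\<close>

lemma inv_lap_altdef:
  "inv_lap u z = (\<Sum>j\<in>UNIV. dz j (dzbar j u) z)
     - of_real ((norm z)\<^sup>2) * (\<Sum>j\<in>UNIV. \<Sum>k\<in>UNIV. z $ j * cnj (z $ k) * dz j (dzbar k u) z)"
proof -
  have "inv_lap u z = (\<Sum>j\<in>UNIV. \<Sum>k\<in>UNIV. (if j = k then dz j (dzbar j u) z else 0)
     - of_real ((norm z)\<^sup>2) * (z $ j * cnj (z $ k) * dz j (dzbar k u) z))"
    unfolding inv_lap_def by (intro sum.cong refl) (simp add: algebra_simps)
  then show ?thesis
    by (simp add: sum_subtractf sum_distrib_left)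
qed

text \<open>Product rule with r = |z|^2. In the trace part the radial factor contributes r \<phi>''
  + n \<phi>', the cross terms (p+q) \<phi>' by Euler, and f nothing by harmonicity. The Levi form
  in direction z contributes r^2 \<phi>'' + r \<phi>' from the radial factor, (p+q) r \<phi>' from
  the cross terms and p q \<phi> from f.\<close>

lemma radial_times_bihom_poly:
  fixes p q :: nat and a :: "('n::finite \<Rightarrow> nat) \<Rightarrow> ('n \<Rightarrow> nat) \<Rightarrow> complex"
    and \<phi> \<phi>1 \<phi>2 :: "real \<Rightarrow> real"
  defines "f \<equiv> bihom_poly p q a"
  assumes \<phi>1: "\<And>r. \<bar>r\<bar> < 1 \<Longrightarrow> (\<phi> has_real_derivative \<phi>1 r) (at r)"
    and \<phi>2: "\<And>r. \<bar>r\<bar> < 1 \<Longrightarrow> (\<phi>1 has_real_derivative \<phi>2 r) (at r)"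
  defines "v \<equiv> \<lambda>z. f z * of_real (\<phi> ((norm z)\<^sup>2))"
  shows "twice_differentiable_on v (ball 0 1)"
    and "z \<in> ball 0 1 \<Longrightarrow> lap f z = 0 \<Longrightarrow> r = (norm z)\<^sup>2 \<Longrightarrow>
      inv_lap v z = f z * of_real (r * \<phi>2 r + (real CARD('n) + real p + real q) * \<phi>1 r
        - r * (r\<^sup>2 * \<phi>2 r + (1 + real p + real q) * r * \<phi>1 r + real p * real q * \<phi> r))"
proof -
  have r1: "\<bar>(norm z)\<^sup>2\<bar> < 1" if "z \<in> ball 0 1" for z :: "complex ^ 'n"
    using that by (simp add: abs_square_less_1)
  have f2: "twice_differentiable_on f UNIV" unfolding f_def by (rule twice_differentiable_bihom_poly)
  then have f: "has_wirtinger f (\<lambda>j. dz j f z) (\<lambda>j. dzbar j f z) z"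
    and df: "dz j f differentiable (at z)" "dzbar j f differentiable (at z)" for z j
    unfolding twice_differentiable_on_def by (auto intro: has_wirtingerI)
  define A where "A = (\<lambda>j z. f z * (of_real (\<phi>1 ((norm z)\<^sup>2)) * cnj (z $ j)) + dz j f z * of_real (\<phi> ((norm z)\<^sup>2)))"
  define B where "B = (\<lambda>j z. f z * (of_real (\<phi>1 ((norm z)\<^sup>2)) * z $ j) + dzbar j f z * of_real (\<phi> ((norm z)\<^sup>2)))"
  have v: "has_wirtinger v (\<lambda>j. A j z) (\<lambda>j. B j z) z" if "z \<in> ball 0 1" for z
    unfolding v_def A_def B_def by (intro has_wirtinger_mult f has_wirtinger_radial \<phi>1 r1 that)
  have rad: "has_wirtinger (\<lambda>z. of_real (\<phi> ((norm z)\<^sup>2))) (\<lambda>j. of_real (\<phi>1 ((norm z)\<^sup>2)) * cnj (z $ j))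
      (\<lambda>j. of_real (\<phi>1 ((norm z)\<^sup>2)) * z $ j) z"
    "has_wirtinger (\<lambda>z. of_real (\<phi>1 ((norm z)\<^sup>2))) (\<lambda>j. of_real (\<phi>2 ((norm z)\<^sup>2)) * cnj (z $ j))
      (\<lambda>j. of_real (\<phi>2 ((norm z)\<^sup>2)) * z $ j) z"
    if "z \<in> ball 0 1" for z :: "complex ^ 'n"
    by (intro has_wirtinger_radial \<phi>1 \<phi>2 r1 that)+
  have "has_wirtinger (\<lambda>z. cnj (z $ j)) (\<lambda>i. cnj 0) (\<lambda>i. cnj (if i = j then 1 else 0)) z" for j and z :: "complex ^ 'n"
    by (intro has_wirtinger_cnj has_wirtinger_coord)
  then have dA': "A j differentiable (at z)" if "z \<in> ball 0 1" for j z
    unfolding A_def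
    using has_wirtinger_mult[OF f has_wirtinger_mult[OF rad(2)[OF that]]]
      has_wirtinger_mult[OF has_wirtingerI[OF df(1)] rad(1)[OF that]]
    by (intro has_wirtinger_differentiable[OF has_wirtinger_add]) blast+
  have B: "has_wirtinger (B k) (\<lambda>j. (f z * (of_real (\<phi>1 ((norm z)\<^sup>2)) * (if j = k then 1 else 0)
      + (of_real (\<phi>2 ((norm z)\<^sup>2)) * cnj (z $ j)) * z $ k) + dz j f z * (of_real (\<phi>1 ((norm z)\<^sup>2)) * z $ k))
      + (dzbar k f z * (of_real (\<phi>1 ((norm z)\<^sup>2)) * cnj (z $ j)) + dz j (dzbar k f) z * of_real (\<phi> ((norm z)\<^sup>2))))
     (\<lambda>j. (f z * (of_real (\<phi>1 ((norm z)\<^sup>2)) * 0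
      + (of_real (\<phi>2 ((norm z)\<^sup>2)) * z $ j) * z $ k) + dzbar j f z * (of_real (\<phi>1 ((norm z)\<^sup>2)) * z $ k))
      + (dzbar k f z * (of_real (\<phi>1 ((norm z)\<^sup>2)) * z $ j) + dzbar j (dzbar k f) z * of_real (\<phi> ((norm z)\<^sup>2)))) z"
    if "z \<in> ball 0 1" for k z
    unfolding B_def
    by (intro has_wirtinger_add has_wirtinger_mult f rad has_wirtinger_coord has_wirtingerI df that)
  have dA: "dz j v z = A j z" and dB: "dzbar j v z = B j z" if "z \<in> ball 0 1" for j z
    using v[OF that] has_wirtinger_dz has_wirtinger_dzbar by blast+
  have dv: "dz j v differentiable (at z)" "dzbar j v differentiable (at z)" if "z \<in> ball 0 1" for j z
    by (rule differentiable_cong_open[OF open_ball that dA dA'[OF that]], assumption)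
      (rule differentiable_cong_open[OF open_ball that dB has_wirtinger_differentiable[OF B[OF that]]], assumption)
  then show "twice_differentiable_on v (ball 0 1)"
    using has_wirtinger_differentiable[OF v] unfolding twice_differentiable_on_def by blast
  assume z: "z \<in> ball 0 1" and lap: "lap f z = 0" and r: "r = (norm z)\<^sup>2"
  define c c1 c2 R where "c = complex_of_real (\<phi> r)" "c1 = complex_of_real (\<phi>1 r)"
    "c2 = complex_of_real (\<phi>2 r)" "R = complex_of_real r"
  have W: "dz j (dzbar k v) z = f z * c1 * (if j = k then 1 else 0) + c2 * f z * (cnj (z $ j) * z $ k)
      + c1 * (z $ k * dz j f z) + c1 * (cnj (z $ j) * dzbar k f z) + c * dz j (dzbar k f) z" for j k
  proof -
    \<comment> \<open>The formula \<open>B k\<close> for the inner derivative is available on the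
      open ball only, which suffices because differentiation is local.\<close>
    have "dz j (dzbar k v) z = dz j (B k) z" by (rule dz_cong[OF open_ball z dB])
    then show ?thesis
      using has_wirtinger_dz[OF B[OF z, of k], of j] unfolding c_c1_c2_R_def r by (simp add: algebra_simps)
  qed
  have zz: "(\<Sum>l\<in>UNIV. z $ l * cnj (z $ l)) = R" unfolding sum_coord_cnj c_c1_c2_R_def r ..
  have zz': "(\<Sum>l\<in>UNIV. cnj (z $ l) * z $ l) = R" unfolding zz[symmetric] by (simp add: mult.commute)
  have harm: "(\<Sum>j\<in>UNIV. dz j (dzbar j f) z) = 0"
    using lap lap_eq_sum_dz_dzbar[OF f2 open_UNIV] by simp
  note euler = euler_dz[of z p q a, folded f_def] euler_dzbar[of z p q a, folded f_def] euler_dz_dzbar[of z p q a, folded f_def]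
  have "(\<Sum>j\<in>UNIV. dz j (dzbar j v) z) = of_nat CARD('n) * (f z * c1) + c2 * f z * R
      + c1 * (of_nat p * f z) + c1 * (of_nat q * f z) + c * 0"
    unfolding W sum.distrib sum_distrib_left[symmetric] zz' euler harm by simp
  moreover have "(\<Sum>j\<in>UNIV. \<Sum>k\<in>UNIV. z $ j * cnj (z $ k) * dz j (dzbar k v) z) =
     f z * c1 * R + c2 * f z * (R * R) + c1 * ((of_nat p * f z) * R) + c1 * (R * (of_nat q * f z))
       + c * (of_nat (p * q) * f z)"
  proof -
    have "(\<Sum>j\<in>UNIV. \<Sum>k\<in>UNIV. z $ j * cnj (z $ k) * dz j (dzbar k v) z) =
      (\<Sum>j\<in>UNIV. \<Sum>k\<in>UNIV. f z * c1 * (if j = k then z $ j * cnj (z $ k) else 0)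
        + c2 * f z * ((z $ j * cnj (z $ j)) * (z $ k * cnj (z $ k)))
        + c1 * ((z $ j * dz j f z) * (z $ k * cnj (z $ k)))
        + c1 * ((z $ j * cnj (z $ j)) * (cnj (z $ k) * dzbar k f z))
        + c * (z $ j * cnj (z $ k) * dz j (dzbar k f) z))"
      unfolding W by (intro sum.cong refl) (simp add: algebra_simps)
    also have "\<dots> = f z * c1 * (\<Sum>j\<in>UNIV. z $ j * cnj (z $ j))
        + c2 * f z * ((\<Sum>j\<in>UNIV. z $ j * cnj (z $ j)) * (\<Sum>k\<in>UNIV. z $ k * cnj (z $ k)))
        + c1 * ((\<Sum>j\<in>UNIV. z $ j * dz j f z) * (\<Sum>k\<in>UNIV. z $ k * cnj (z $ k)))
        + c1 * ((\<Sum>j\<in>UNIV. z $ j * cnj (z $ j)) * (\<Sum>k\<in>UNIV. cnj (z $ k) * dzbar k f z))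
        + c * (\<Sum>j\<in>UNIV. \<Sum>k\<in>UNIV. z $ j * cnj (z $ k) * dz j (dzbar k f) z)"
      unfolding sum.distrib sum_product sum_distrib_left[symmetric] by simp
    finally show ?thesis unfolding zz euler .
  qed
  ultimately show "inv_lap v z = f z * of_real (r * \<phi>2 r + (real CARD('n) + real p + real q) * \<phi>1 r
        - r * (r\<^sup>2 * \<phi>2 r + (1 + real p + real q) * r * \<phi>1 r + real p * real q * \<phi> r))"
    unfolding inv_lap_altdef r[symmetric] c_c1_c2_R_def
    by (simp add: algebra_simps power2_eq_square)
qed

section \<open>Hypergeometric series and their singularity at 1\<close>

definition hyp_coeff :: "real \<Rightarrow> real \<Rightarrow> real \<Rightarrow> nat \<Rightarrow> real" where
  "hyp_coeff a b c k = pochhammer a k * pochhammer b k / (pochhammer c k * fact k)"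

context
  fixes a b c :: real
  assumes abc: "a > 0" "b > 0" "c > 0"
begin

lemma hyp_coeff_pos: "hyp_coeff a b c k > 0"
  unfolding hyp_coeff_def using abc by (simp add: pochhammer_pos)

lemma hyp_coeff_Suc: "real (Suc k) * (c + k) * hyp_coeff a b c (Suc k) = (a + k) * (b + k) * hyp_coeff a b c k"
  unfolding hyp_coeff_def pochhammer_Suc fact_Suc
  using abc pochhammer_pos[of c k] by (simp add: field_simps add_nonneg_eq_0_iff)

text \<open>Gauss's product formula: \<open>pochhammer z (Suc n)\<close> is
  \<open>fact n * real n powr z\<close> divided by \<open>Gamma_series z n\<close>, so the
  coefficient is a quotient of three Gamma series times a power. \<open>Gamma_series\<close> at
  \<open>n\<close> involves the Pochhammer symbol at \<open>Suc n\<close>; hence the index shift and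
  the correcting power of \<open>Suc n / n\<close>, which tends to 1.\<close>

lemma hyp_coeff_asymp:
  "(\<lambda>k. hyp_coeff a b c k * real k powr (c - a - b + 1)) \<longlonglongrightarrow> Gamma c / (Gamma a * Gamma b)"
proof (rule LIMSEQ_imp_Suc)
  have G: "Gamma_series z \<longlonglongrightarrow> Gamma z" for z :: real by (rule Gamma_series_LIMSEQ)
  have pos: "Gamma a > 0" "Gamma b > 0" using abc by (auto intro: Gamma_real_pos)
  have 1: "(\<lambda>n. (real (Suc n) / real n) powr (c - a - b)) \<longlonglongrightarrow> 1 powr (c - a - b)"
    by (intro tendsto_intros LIMSEQ_Suc_n_over_n) simp
  have "(\<lambda>n. Gamma_series c n / (Gamma_series a n * Gamma_series b n) *
      (real (Suc n) / real n) powr (c - a - b)) \<longlonglongrightarrow> Gamma c / (Gamma a * Gamma b) * 1 powr (c - a - b)"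
    using pos by (intro tendsto_intros G 1) auto
  moreover have "\<forall>\<^sub>F n in sequentially. Gamma_series c n / (Gamma_series a n * Gamma_series b n) *
      (real (Suc n) / real n) powr (c - a - b)
      = hyp_coeff a b c (Suc n) * real (Suc n) powr (c - a - b + 1)"
    using eventually_gt_at_top[of 0]
  proof eventually_elim
    case (elim n)
    have gs: "Gamma_series z n = fact n * real n powr z / pochhammer z (Suc n)" for z :: real
      using elim unfolding Gamma_series_def by (simp add: powr_def mult.commute)
    define P where "P = (\<lambda>z::real. pochhammer z (Suc n))"
    have P: "P a > 0" "P b > 0" "P c > 0" unfolding P_def using abc by (auto intro: pochhammer_pos)
    have "real n powr c = real n powr (c - a - b) * real n powr a * real n powr b"
      using elim by (simp add: powr_add[symmetric])
    moreover have "real (Suc n) powr (c - a - b + 1) = real (Suc n) powr (c - a - b) * real (Suc n)"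
      by (simp add: powr_add)
    moreover have "(real (Suc n) / real n) powr (c - a - b) = real (Suc n) powr (c - a - b) / real n powr (c - a - b)"
      by (rule powr_divide)
    moreover have "real n powr x > 0" for x using elim by simp
    ultimately show ?case
      unfolding gs hyp_coeff_def P_def[symmetric] using P
      by (simp add: divide_simps mult.commute)
  qed
  ultimately show "(\<lambda>n. hyp_coeff a b c (Suc n) * real (Suc n) powr (c - a - b + 1)) \<longlonglongrightarrow> Gamma c / (Gamma a * Gamma b)"
    using Lim_transform_eventually by fastforce
qed

lemma hyp_coeff_bounds:
  obtains l u where "l > 0"
    "\<forall>\<^sub>F k in sequentially. l * real k powr - (c - a - b + 1) \<le> hyp_coeff a b c k"
    "\<forall>\<^sub>F k in sequentially. hyp_coeff a b c k \<le> u * real k powr - (c - a - b + 1)"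
proof -
  define G where "G = Gamma c / (Gamma a * Gamma b)"
  have G: "G > 0" unfolding G_def using abc by (auto intro!: divide_pos_pos mult_pos_pos Gamma_real_pos)
  have "\<forall>\<^sub>F k in sequentially. G / 2 < hyp_coeff a b c k * real k powr (c - a - b + 1)"
    "\<forall>\<^sub>F k in sequentially. hyp_coeff a b c k * real k powr (c - a - b + 1) < 2 * G"
    using order_tendstoD(1)[OF hyp_coeff_asymp[folded G_def], of "G / 2"]
      order_tendstoD(2)[OF hyp_coeff_asymp[folded G_def], of "2 * G"] G by simp_all
  then have "\<forall>\<^sub>F k in sequentially. G / 2 * real k powr - (c - a - b + 1) \<le> hyp_coeff a b c k"
    "\<forall>\<^sub>F k in sequentially. hyp_coeff a b c k \<le> 2 * G * real k powr - (c - a - b + 1)"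
    using eventually_gt_at_top[of 0]
    by (eventually_elim, simp only: powr_minus divide_inverse[symmetric], simp add: pos_divide_le_eq pos_le_divide_eq)+
  then show ?thesis using that[of "G / 2" "2 * G"] G by simp
qed

lemma summable_hyp_coeff:
  assumes "c - a - b > 0"
  shows "summable (hyp_coeff a b c)"
proof -
  obtain l u :: real where "\<forall>\<^sub>F k in sequentially. hyp_coeff a b c k \<le> u * real k powr - (c - a - b + 1)"
    using hyp_coeff_bounds by blast
  then have "\<forall>\<^sub>F k in sequentially. norm (hyp_coeff a b c k) \<le> u * real k powr - (c - a - b + 1)"
    using hyp_coeff_pos by (simp add: less_imp_le)
  moreover have "summable (\<lambda>k. u * real k powr - (c - a - b + 1))"
    using assms by (intro summable_mult) (simp add: summable_real_powr_iff)
  ultimately show ?thesis by (rule summable_comparison_test_ev)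
qed

end

section \<open>Power series on (-1,1): derivatives, the hypergeometric equation, limits at 1\<close>

definition powser :: "(nat \<Rightarrow> real) \<Rightarrow> real \<Rightarrow> real" where
  "powser d t = (\<Sum>j. d j * t ^ j)"

lemma powser_has_derivative:
  assumes "\<And>t. \<bar>t\<bar> < 1 \<Longrightarrow> summable (\<lambda>j. d j * t ^ j)" "\<bar>t\<bar> < 1"
  shows "(powser d has_real_derivative powser (diffs d) t) (at t)"
  using termdiffs_strong'[of 1 d t] assms unfolding powser_def[abs_def] by simp

lemma summable_diffs:
  fixes d :: "nat \<Rightarrow> real"
  assumes "\<And>t. \<bar>t\<bar> < 1 \<Longrightarrow> summable (\<lambda>j. d j * t ^ j)" "\<bar>t\<bar> < 1"
  shows "summable (\<lambda>j. diffs d j * t ^ j)"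
  using termdiff_converges[of t 1 d] assms by simp

lemma summable_diffs_funpow:
  fixes d :: "nat \<Rightarrow> real"
  assumes "\<And>t. \<bar>t\<bar> < 1 \<Longrightarrow> summable (\<lambda>j. d j * t ^ j)" "\<bar>t\<bar> < 1"
  shows "summable (\<lambda>j. (diffs ^^ m) d j * t ^ j)"
  using assms(2) by (induction m arbitrary: t) (auto intro: summable_diffs assms(1))

text \<open>The exact multiplier of \<open>d (j + m)\<close> is (j+1)(j+2)...(j+m), and each of
  these m factors is at least j + 1. A lower bound is enough, since only divergence has to be
  shown.\<close>

lemma diffs_funpow_ge:
  fixes d :: "nat \<Rightarrow> real"
  assumes "\<And>j. d j \<ge> 0"
  shows "(diffs ^^ m) d j \<ge> (real j + 1) ^ m * d (j + m)"
proof (induction m arbitrary: j)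
  case (Suc m)
  have "(real j + 1) ^ Suc m * d (j + Suc m) \<le> (real j + 1) * ((real (Suc j) + 1) ^ m * d (Suc j + m))"
    using assms by (simp add: mult_left_mono mult_right_mono power_mono)
  also have "\<dots> \<le> (real j + 1) * (diffs ^^ m) d (Suc j)"
    using Suc[of "Suc j"] by (intro mult_left_mono) auto
  also have "\<dots> = (diffs ^^ Suc m) d j"
    by (simp add: diffs_def)
  finally show ?case .
qed simp

text \<open>Comparing coefficients of s^j, the equation is exactly the two-term recursion
  \<open>hyp_coeff_Suc\<close>.\<close>

lemma hypergeometric_ode:
  assumes abc: "a > 0" "b > 0" "c - a - b > 0" and s: "\<bar>s\<bar> < 1"
  defines "h \<equiv> hyp_coeff a b c"
  shows "s * (1 - s) * powser (diffs (diffs h)) s + (c - (a + b + 1) * s) * powser (diffs h) s - a * b * powser h s = 0"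
proof -
  have c: "c > 0" using abc by linarith
  have sm: "summable (\<lambda>j. h j * t ^ j)" if "\<bar>t\<bar> < 1" for t
  proof (rule summable_comparison_test'[OF summable_hyp_coeff[OF abc(1,2) c abc(3)]])
    show "norm (h j * t ^ j) \<le> hyp_coeff a b c j" for j
      using hyp_coeff_pos[OF abc(1,2) c, of j] that unfolding h_def
      by (simp add: abs_mult power_abs mult_left_le power_le_one)
  qed
  have S: "(\<lambda>j. h j * s ^ j) sums powser h s" "(\<lambda>j. diffs h j * s ^ j) sums powser (diffs h) s"
    "(\<lambda>j. diffs (diffs h) j * s ^ j) sums powser (diffs (diffs h)) s"
    unfolding powser_def using s by (auto intro!: summable_sums sm summable_diffs)
  \<comment> \<open>Multiplication by s shifts the index so that all series run over the same
    powers; the factor \<open>real j\<close> makes the added term at 0 vanish. \<open>T2\<close> and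
    \<open>T3\<close> follow the same pattern.\<close>
  have T1: "(\<lambda>j. real j * h j * s ^ j) sums (s * powser (diffs h) s)"
  proof -
    have "(\<lambda>j. s * (diffs h j * s ^ j)) sums (s * powser (diffs h) s)" by (intro sums_mult S)
    then have "(\<lambda>j. real (Suc j) * h (Suc j) * s ^ Suc j) sums (s * powser (diffs h) s)"
      by (simp add: diffs_def ac_simps)
    then show ?thesis by (subst (asm) sums_Suc_iff) simp
  qed
  have T2: "(\<lambda>j. real j * diffs h j * s ^ j) sums (s * powser (diffs (diffs h)) s)"
  proof -
    have "(\<lambda>j. s * (diffs (diffs h) j * s ^ j)) sums (s * powser (diffs (diffs h)) s)" by (intro sums_mult S)
    then have "(\<lambda>j. real (Suc j) * diffs h (Suc j) * s ^ Suc j) sums (s * powser (diffs (diffs h)) s)"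
      by (simp add: diffs_def[of "diffs h"] ac_simps)
    then show ?thesis by (subst (asm) sums_Suc_iff) simp
  qed
  have T3: "(\<lambda>j. real j * (real j - 1) * h j * s ^ j) sums (s * (s * powser (diffs (diffs h)) s))"
  proof -
    have "(\<lambda>j. s * (real j * diffs h j * s ^ j)) sums (s * (s * powser (diffs (diffs h)) s))" by (intro sums_mult T2)
    then have "(\<lambda>j. real (Suc j) * (real (Suc j) - 1) * h (Suc j) * s ^ Suc j) sums (s * (s * powser (diffs (diffs h)) s))"
      by (simp add: diffs_def ac_simps)
    then show ?thesis by (subst (asm) sums_Suc_iff) simp
  qed
  have "(\<lambda>j. real j * diffs h j * s ^ j - real j * (real j - 1) * h j * s ^ j + c * (diffs h j * s ^ j)
      - (a + b + 1) * (real j * h j * s ^ j) - a * b * (h j * s ^ j)) sums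
    (s * powser (diffs (diffs h)) s - s * (s * powser (diffs (diffs h)) s) + c * powser (diffs h) s
      - (a + b + 1) * (s * powser (diffs h) s) - a * b * powser h s)"
    by (intro sums_add sums_diff sums_mult S T1 T2 T3)
  moreover have "real j * diffs h j * s ^ j - real j * (real j - 1) * h j * s ^ j + c * (diffs h j * s ^ j)
      - (a + b + 1) * (real j * h j * s ^ j) - a * b * (h j * s ^ j) = 0" for j
  proof -
    have "real j * diffs h j * s ^ j - real j * (real j - 1) * h j * s ^ j + c * (diffs h j * s ^ j)
      - (a + b + 1) * (real j * h j * s ^ j) - a * b * (h j * s ^ j) =
      (real (Suc j) * (c + j) * h (Suc j) - (a + j) * (b + j) * h j) * s ^ j"
      by (simp add: diffs_def algebra_simps)
    then show ?thesis using hyp_coeff_Suc[OF abc(1,2) c] unfolding h_def by simp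
  qed
  ultimately have "(\<lambda>j::nat. 0) sums
    (s * powser (diffs (diffs h)) s - s * (s * powser (diffs (diffs h)) s) + c * powser (diffs h) s
      - (a + b + 1) * (s * powser (diffs h) s) - a * b * powser h s)" by simp
  from sums_unique2[OF this sums_zero] show ?thesis by (simp add: algebra_simps)
qed

text \<open>The elementary Tauberian direction for nonnegative terms: each polynomial partial sum is
  at most \<open>powser d t\<close>, and it is continuous at t = 1.\<close>

lemma summable_of_bounded_powser:
  assumes d: "\<And>j. d j \<ge> 0" and sm: "\<And>t. \<bar>t\<bar> < 1 \<Longrightarrow> summable (\<lambda>j. d j * t ^ j)"
    and bd: "\<And>t. 0 \<le> t \<Longrightarrow> t < 1 \<Longrightarrow> powser d t \<le> M"
  shows "summable d"
proof (rule summableI_nonneg_bounded[OF d])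
  fix n
  show "sum d {..<n} \<le> M"
  proof (rule tendsto_upperbound)
    show "((\<lambda>t. \<Sum>j<n. d j * t ^ j) \<longlongrightarrow> sum d {..<n}) (at_left 1)"
      by (rule tendsto_eq_intros refl | simp)+
    show "\<forall>\<^sub>F t in at_left 1. (\<Sum>j<n. d j * t ^ j) \<le> M"
      using eventually_at_left_real[of 0 1, OF zero_less_one]
    proof eventually_elim
      case (elim t)
      then have "(\<Sum>j<n. d j * t ^ j) \<le> powser d t"
        unfolding powser_def using d by (intro sum_le_suminf sm) auto
      then show ?case using bd[of t] elim by simp
    qed
  qed simp
qed

text \<open>The Hoelder bound holds inside the interval only. Discarding nonnegative terms leaves a
  finite sum, in which s can tend to 1 although nothing is known about \<open>powser d\<close> at 1
  itself.\<close>

lemma powser_holder_sum_le: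
  assumes d: "\<And>j. d j \<ge> 0" and sm: "\<And>t. \<bar>t\<bar> < 1 \<Longrightarrow> summable (\<lambda>j. d j * t ^ j)"
    and bd: "\<And>t s. 0 \<le> t \<Longrightarrow> t < s \<Longrightarrow> s < 1 \<Longrightarrow> powser d s - powser d t \<le> C * (s - t) powr \<alpha>"
    and J: "finite J" and t: "0 \<le> t" "t < 1"
  shows "(\<Sum>j\<in>J. d j * (1 - t ^ j)) \<le> C * (1 - t) powr \<alpha>"
proof (rule tendsto_le)
  show "((\<lambda>s. C * (s - t) powr \<alpha>) \<longlongrightarrow> C * (1 - t) powr \<alpha>) (at_left 1)"
    using t by (intro tendsto_intros) auto
  show "((\<lambda>s. \<Sum>j\<in>J. d j * (s ^ j - t ^ j)) \<longlongrightarrow> (\<Sum>j\<in>J. d j * (1 - t ^ j))) (at_left 1)"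
    by (rule tendsto_eq_intros refl | simp)+
  show "\<forall>\<^sub>F s in at_left 1. (\<Sum>j\<in>J. d j * (s ^ j - t ^ j)) \<le> C * (s - t) powr \<alpha>"
    using eventually_at_left_real[OF t(2)]
  proof eventually_elim
    case (elim s)
    have "(\<lambda>j. d j * s ^ j) sums powser d s" "(\<lambda>j. d j * t ^ j) sums powser d t"
      unfolding powser_def using elim t by (auto intro!: summable_sums sm)
    from sums_diff[OF this] have S: "(\<lambda>j. d j * (s ^ j - t ^ j)) sums (powser d s - powser d t)"
      by (simp add: right_diff_distrib)
    have "(\<Sum>j\<in>J. d j * (s ^ j - t ^ j)) \<le> (\<Sum>j. d j * (s ^ j - t ^ j))"
      using J d elim t by (intro sum_le_suminf sums_summable[OF S]) (auto intro!: mult_nonneg_nonneg power_mono)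
    also have "\<dots> = powser d s - powser d t" using sums_unique[OF S] by simp
    also have "\<dots> \<le> C * (s - t) powr \<alpha>" using bd[of t s] elim t by simp
    finally show ?case .
  qed
qed simp

text \<open>\<open>spread N h\<close> is the coefficient sequence of \<open>t ^ N * F (t ^ 4)\<close> where \<open>F\<close> has coefficients \<open>h\<close>;
  the fourth power arises because the solution depends on \<open>|z|\<^sup>4\<close>.\<close>

definition spread :: "nat \<Rightarrow> (nat \<Rightarrow> real) \<Rightarrow> nat \<Rightarrow> real" where
  "spread N h j = (if N \<le> j \<and> 4 dvd (j - N) then h ((j - N) div 4) else 0)"

lemma spread_eq: "spread N h (N + 4 * k) = h k"
  by (simp add: spread_def)

lemma spread_nonneg: "(\<And>k. h k \<ge> 0) \<Longrightarrow> spread N h j \<ge> 0"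
  by (simp add: spread_def)

lemma spread_sums:
  assumes "(\<lambda>k. h k * (t ^ 4) ^ k) sums S"
  shows "(\<lambda>j. spread N h j * t ^ j) sums (t ^ N * S)"
proof -
  have "(\<lambda>k. t ^ N * (h k * (t ^ 4) ^ k)) sums (t ^ N * S)" by (intro sums_mult assms)
  then have "(\<lambda>k. spread N h (N + 4 * k) * t ^ (N + 4 * k)) sums (t ^ N * S)"
    unfolding spread_eq by (simp only: power_add power_mult mult.left_commute)
  moreover have "strict_mono (\<lambda>k. N + 4 * k)" by (simp add: strict_mono_def)
  moreover have "spread N h j * t ^ j = 0" if "j \<notin> range (\<lambda>k. N + 4 * k)" for j
  proof -
    have "\<not> (N \<le> j \<and> 4 dvd (j - N))" using that by (auto elim!: dvdE simp: image_iff) (metis le_add_diff_inverse)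
    then have "spread N h j = 0" unfolding spread_def by (rule if_not_P)
    then show ?thesis by simp
  qed
  ultimately show ?thesis using sums_mono_reindex[of "\<lambda>k. N + 4 * k" "\<lambda>j. spread N h j * t ^ j"] by blast
qed

text \<open>Differentiating m times lowers the exponent N + 4k by m. The condition
  \<open>k \<ge> m\<close> keeps the subtraction exact and makes the base N + 4k - m + 1 of the
  previous estimate at least k.\<close>

lemma diffs_spread_ge:
  assumes "\<And>k. h k \<ge> 0" "k \<ge> m"
  shows "(diffs ^^ m) (spread N h) (N + 4 * k - m) \<ge> real k ^ m * h k"
proof -
  have "real k \<le> real (N + 4 * k - m) + 1" using assms(2) by linarith
  then have "real k ^ m * h k \<le> (real (N + 4 * k - m) + 1) ^ m * h k"
    using assms(1) by (intro mult_right_mono power_mono) auto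
  also have "\<dots> = (real (N + 4 * k - m) + 1) ^ m * spread N h (N + 4 * k - m + m)"
    using assms(2) by (simp add: spread_eq)
  also have "\<dots> \<le> (diffs ^^ m) (spread N h) (N + 4 * k - m)"
    using assms(1) by (intro diffs_funpow_ge spread_nonneg)
  finally show ?thesis .
qed

section \<open>Singularity at 1 of the m-th derivative of the respaced hypergeometric series\<close>

context
  fixes a b c :: real and m N :: nat
  assumes ab: "a > 0" "b > 0" and pos: "c - a - b > 0"
begin

abbreviation (input) "D \<equiv> (diffs ^^ m) (spread N (hyp_coeff a b c))"

lemma hyp_coeff_denom_pos: "c > 0" using ab pos by linarith

lemma hyp_coeff_nonneg: "hyp_coeff a b c k \<ge> 0"
  using hyp_coeff_pos[OF ab hyp_coeff_denom_pos] by (simp add: less_imp_le)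

lemma diffs_spread_hyp_nonneg: "D j \<ge> 0"
  by (rule order_trans[OF _ diffs_funpow_ge]) (auto intro!: mult_nonneg_nonneg spread_nonneg hyp_coeff_nonneg)

lemma summable_hyp_powser:
  assumes "\<bar>t\<bar> \<le> 1"
  shows "summable (\<lambda>j. hyp_coeff a b c j * t ^ j)"
proof (rule summable_comparison_test'[OF summable_hyp_coeff[OF ab hyp_coeff_denom_pos pos]])
  show "norm (hyp_coeff a b c j * t ^ j) \<le> hyp_coeff a b c j" for j
    using hyp_coeff_nonneg assms by (simp add: abs_mult power_abs mult_left_le power_le_one)
qed

lemma summable_spread:
  assumes "\<bar>t\<bar> < 1"
  shows "summable (\<lambda>j. spread N (hyp_coeff a b c) j * t ^ j)"
proof -
  have "\<bar>t ^ 4\<bar> \<le> 1" using power_le_one[of "\<bar>t\<bar>" 4] assms by simp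
  then show ?thesis
    using spread_sums[OF summable_sums[OF summable_hyp_powser]] by (blast intro: sums_summable)
qed

text \<open>\<open>e\<close> is what m derivatives leave of the exponent c - a - b: the factor k^m
  cancels all but k^-(e+1) of the coefficient decay. It is used with e = 0 and e = 1/2.\<close>

lemma diffs_spread_hyp_ge:
  fixes e :: real
  assumes "c - a - b = real m + e"
  obtains l K where "l > 0" "\<And>k. k \<ge> K \<Longrightarrow> D (N + 4 * k - m) \<ge> l * real k powr - (e + 1)"
proof -
  obtain l u :: real where l: "l > 0"
    "\<forall>\<^sub>F k in sequentially. l * real k powr - (c - a - b + 1) \<le> hyp_coeff a b c k"
    using hyp_coeff_bounds[OF ab hyp_coeff_denom_pos] by blast
  have "\<forall>\<^sub>F k in sequentially. D (N + 4 * k - m) \<ge> l * real k powr - (e + 1)"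
    using l(2) eventually_ge_at_top[of m] eventually_gt_at_top[of 0]
  proof eventually_elim
    case (elim k)
    have "l * real k powr - (e + 1) = real k ^ m * (l * real k powr - (c - a - b + 1))"
      unfolding assms using elim by (simp add: powr_realpow[symmetric] powr_add[symmetric])
    also have "\<dots> \<le> real k ^ m * hyp_coeff a b c k"
      using elim(1) by (intro mult_left_mono) auto
    also have "\<dots> \<le> D (N + 4 * k - m)" by (intro diffs_spread_ge hyp_coeff_nonneg elim)
    finally show ?case .
  qed
  then show ?thesis using that l(1) unfolding eventually_sequentially by blast
qed

text \<open>Here e = 0, so along the exponents N + 4k - m the coefficients dominate a multiple of
  1/k. Boundedness would make them summable, and with them the harmonic series.\<close>

lemma powser_diffs_spread_unbounded:
  assumes "c - a - b = m"
  shows "\<exists>t. 0 \<le> t \<and> t < 1 \<and> powser D t > M"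
proof (rule ccontr)
  assume "\<not> ?thesis"
  then have bd: "powser D t \<le> M" if "0 \<le> t" "t < 1" for t using that by (meson not_le)
  have "summable D"
    by (rule summable_of_bounded_powser[OF diffs_spread_hyp_nonneg summable_diffs_funpow[OF summable_spread] bd])
  obtain l :: real and K where l: "l > 0" "\<And>k. k \<ge> K \<Longrightarrow> D (N + 4 * k - m) \<ge> l * real k powr - (0 + 1)"
    using diffs_spread_hyp_ge[of 0] assms by auto
  \<comment> \<open>Starting at k = i + m keeps the subtraction of m exact, so \<open>g\<close> is
    injective and reindexing applies.\<close>
  define g where "g = (\<lambda>i. N + 4 * (i + m) - m)"
  have "summable (D \<circ> g)"
    by (rule summable_reindex[OF \<open>summable D\<close> _ diffs_spread_hyp_nonneg]) (auto simp: g_def inj_def)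
  then have sm: "summable (\<lambda>i. (1 / l) * D (g i))" by (intro summable_mult) (simp add: o_def)
  have le: "norm (inverse (real (i + m))) \<le> (1 / l) * D (g i)" if "i \<ge> K" for i
    using l(2)[of "i + m"] l(1) that unfolding g_def by (simp add: powr_minus field_simps)
  have "summable (\<lambda>i. inverse (real (i + m)))"
    by (rule summable_comparison_test'[OF sm le])
  then show False
    using not_summable_harmonic[where 'a = real] unfolding summable_iff_shift[of "\<lambda>i. inverse (real i)" m] by blast
qed

text \<open>Test at t = 1 - 1/K against the block of indices from K to 2K. Its K terms each have a
  coefficient of order at least K^-(3/2) and a factor 1 - t^j \<ge> 1/2, so the increment up to 1 is
  at least of order K^-(1/2). The Hoelder bound allows only K^-\<alpha>, which is smaller as K
  grows.\<close>

lemma powser_diffs_spread_not_holder: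
  assumes half: "c - a - b = m + 1 / 2" and \<alpha>: "\<alpha> > 1 / 2"
  shows "\<exists>t s. 0 \<le> t \<and> t < s \<and> s < 1 \<and> powser D s - powser D t > C * (s - t) powr \<alpha>"
proof (rule ccontr)
  assume "\<not> ?thesis"
  then have bd: "powser D s - powser D t \<le> C * (s - t) powr \<alpha>" if "0 \<le> t" "t < s" "s < 1" for s t
    using that by (meson not_le)
  obtain l K0 where l: "l > 0" "\<And>k. k \<ge> K0 \<Longrightarrow> D (N + 4 * k - m) \<ge> l * real k powr - (1 / 2 + 1)"
    using diffs_spread_hyp_ge[OF half] by blast
  \<comment> \<open>The factor 2^-(3/2) comes from replacing k < 2K by 2K in the coefficient bound,
    and the final 1/2 from \<open>tj\<close>.\<close>
  define l' where "l' = l * 2 powr - (3 / 2) / 2"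
  have l': "l' > 0" unfolding l'_def using l by simp
  have key: "l' \<le> C * real K powr (1 / 2 - \<alpha>)" if K: "K \<ge> K0" "K \<ge> m" "K > 0" for K
  proof -
    define t where "t = 1 - 1 / real K"
    define J where "J = (\<lambda>k. N + 4 * k - m) ` {K..<2 * K}"
    have t: "0 \<le> t" "t < 1" unfolding t_def using K by simp_all
    have inj: "inj_on (\<lambda>k. N + 4 * k - m) {K..<2 * K}" using K by (auto simp: inj_on_def)
    \<comment> \<open>(1 - 1/K)^K \<le> exp (-1) \<le> 1/2. It applies to the exponents N + 4k - m
      because k \<ge> K \<ge> m makes them at least K.\<close>
    have tj: "1 - t ^ j \<ge> 1 / 2" if "j \<ge> K" for j
    proof -
      have "t ^ j \<le> t ^ K" using t that by (intro power_decreasing) auto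
      also have "\<dots> \<le> exp (- 1 / real K) ^ K"
        using t exp_ge_add_one_self[of "- 1 / real K"] by (intro power_mono) (auto simp: t_def)
      also have "\<dots> = exp (- 1)" using K by (simp add: exp_of_nat_mult[symmetric])
      also have "\<dots> \<le> 1 / 2" using exp_ge_add_one_self[of 1] by (simp add: exp_minus field_simps)
      finally show ?thesis by simp
    qed
    have "l' * real K powr - (1 / 2) = (\<Sum>k\<in>{K..<2 * K}. l * real (2 * K) powr - (3 / 2) * (1 / 2))"
    proof -
      have "real K powr - (1 / 2) = real K * real K powr - (3 / 2)"
        using K powr_add[of "real K" 1 "- (3/2)"] by simp
      then show ?thesis unfolding l'_def by (simp add: powr_mult)
    qed
    also have "\<dots> \<le> (\<Sum>k\<in>{K..<2 * K}. D (N + 4 * k - m) * (1 - t ^ (N + 4 * k - m)))"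
    proof (rule sum_mono)
      fix k assume k: "k \<in> {K..<2 * K}"
      have "l * real (2 * K) powr - (3 / 2) \<le> l * real k powr - (3 / 2)"
        using k K l by (intro mult_left_mono powr_mono2') auto
      also have "\<dots> \<le> D (N + 4 * k - m)" using l(2)[of k] k K by simp
      finally show "l * real (2 * K) powr - (3 / 2) * (1 / 2) \<le> D (N + 4 * k - m) * (1 - t ^ (N + 4 * k - m))"
        using tj[of "N + 4 * k - m"] k K l by (intro mult_mono diffs_spread_hyp_nonneg) auto
    qed
    also have "\<dots> = (\<Sum>j\<in>J. D j * (1 - t ^ j))" unfolding J_def by (simp add: sum.reindex[OF inj])
    also have "\<dots> \<le> C * (1 - t) powr \<alpha>"
      by (rule powser_holder_sum_le[OF diffs_spread_hyp_nonneg summable_diffs_funpow[OF summable_spread] bd _ t])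
        (auto simp: J_def)
    also have "(1 - t) powr \<alpha> = real K powr - \<alpha>"
      unfolding t_def by (simp add: powr_minus powr_divide inverse_eq_divide)
    finally have "l' * real K powr - (1 / 2) * real K powr (1 / 2)
        \<le> C * real K powr - \<alpha> * real K powr (1 / 2)"
      by (intro mult_right_mono) auto
    then show ?thesis
      using K by (simp add: mult.assoc powr_add[symmetric] add.commute)
  qed
  have "(\<lambda>K. C * real K powr (1 / 2 - \<alpha>)) \<longlonglongrightarrow> C * 0"
    using \<alpha> by (intro tendsto_mult_left tendsto_neg_powr filterlim_real_sequentially) simp
  moreover have "\<forall>\<^sub>F K in sequentially. l' \<le> C * real K powr (1 / 2 - \<alpha>)"
    using eventually_ge_at_top[of K0] eventually_ge_at_top[of m] eventually_gt_at_top[of 0]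
    by eventually_elim (rule key)
  ultimately have "l' \<le> C * 0"
    by (rule tendsto_lowerbound) simp
  then show False using l' by simp
qed

end

section \<open>Derivatives along rays\<close>

text \<open>The k-th derivative of t -> u(t \<zeta>), expanded into the coordinate derivatives of
  which the regularity classes speak. The sum runs over words of basis vectors rather than
  multi-indices, so that higher partials never have to be interchanged.\<close>

definition ray_deriv ::
  "nat \<Rightarrow> ('a::euclidean_space \<Rightarrow> 'b::real_normed_vector) \<Rightarrow> 'a \<Rightarrow> real \<Rightarrow> 'b" where
  "ray_deriv k u \<zeta> t = (\<Sum>ds\<in>{ds. set ds \<subseteq> Basis \<and> length ds = k}.
      (\<Prod>d\<leftarrow>ds. \<zeta> \<bullet> d) *\<^sub>R iter_pd ds u (t *\<^sub>R \<zeta>))"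

lemma ray_deriv_0:
  fixes u :: "'a::euclidean_space \<Rightarrow> 'b::real_normed_vector"
  shows "ray_deriv 0 u \<zeta> t = u (t *\<^sub>R \<zeta>)"
proof -
  have "{ds. set ds \<subseteq> (Basis :: 'a set) \<and> length ds = 0} = {[]}" by auto
  then show ?thesis unfolding ray_deriv_def by simp
qed

lemma pd_eq_sum_Basis:
  fixes f :: "'a::euclidean_space \<Rightarrow> 'b::real_normed_vector"
  assumes "f differentiable (at x)"
  shows "pd v f x = (\<Sum>b\<in>Basis. (v \<bullet> b) *\<^sub>R pd b f x)"
proof -
  have lin: "linear (\<lambda>v. pd v f x)"
    using has_derivative_linear[OF has_derivative_pd[OF assms]] .
  have "pd v f x = pd (\<Sum>b\<in>Basis. (v \<bullet> b) *\<^sub>R b) f x" by (simp add: euclidean_representation)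
  then show ?thesis by (simp add: linear_sum[OF lin] linear_cmul[OF lin])
qed

lemma ray_deriv_has_vector_derivative:
  fixes u :: "'a::euclidean_space \<Rightarrow> 'b::real_normed_vector"
  assumes "Ck_on k U u" "j < k" "t *\<^sub>R \<zeta> \<in> U"
  shows "(ray_deriv j u \<zeta> has_vector_derivative ray_deriv (Suc j) u \<zeta> t) (at t)"
proof -
  let ?L = "\<lambda>j. {ds. set ds \<subseteq> (Basis :: 'a set) \<and> length ds = j}"
  have d: "iter_pd ds u differentiable (at (t *\<^sub>R \<zeta>))" if "ds \<in> ?L j" for ds
    using assms that unfolding Ck_on_def by auto
  have "(ray_deriv j u \<zeta> has_vector_derivative
      (\<Sum>ds\<in>?L j. (\<Prod>d\<leftarrow>ds. \<zeta> \<bullet> d) *\<^sub>R pd \<zeta> (iter_pd ds u) (t *\<^sub>R \<zeta>))) (at t)"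
    unfolding ray_deriv_def
  proof (rule has_vector_derivative_sum)
    fix ds assume "ds \<in> ?L j"
    then have "((\<lambda>t. iter_pd ds u (t *\<^sub>R \<zeta>)) has_vector_derivative pd \<zeta> (iter_pd ds u) (t *\<^sub>R \<zeta>)) (at t)"
      using has_vector_derivative_along_line[of "iter_pd ds u" 0 t \<zeta>] d by simp
    then show "((\<lambda>t. (\<Prod>d\<leftarrow>ds. \<zeta> \<bullet> d) *\<^sub>R iter_pd ds u (t *\<^sub>R \<zeta>)) has_vector_derivative
        (\<Prod>d\<leftarrow>ds. \<zeta> \<bullet> d) *\<^sub>R pd \<zeta> (iter_pd ds u) (t *\<^sub>R \<zeta>)) (at t)"
      by (rule bounded_linear.has_vector_derivative[OF bounded_linear_scaleR_right])
  qed
  \<comment> \<open>\<open>iter_pd\<close> applies the head of the list last, so one further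
    derivative, expanded in the basis, prepends a letter to each word.\<close>
  also have "(\<Sum>ds\<in>?L j. (\<Prod>d\<leftarrow>ds. \<zeta> \<bullet> d) *\<^sub>R pd \<zeta> (iter_pd ds u) (t *\<^sub>R \<zeta>)) =
      (\<Sum>ds\<in>?L j. \<Sum>b\<in>Basis. (\<Prod>d\<leftarrow>b # ds. \<zeta> \<bullet> d) *\<^sub>R iter_pd (b # ds) u (t *\<^sub>R \<zeta>))"
    by (intro sum.cong refl) (simp add: pd_eq_sum_Basis[OF d, where v = \<zeta>] scaleR_sum_right mult.commute)
  also have "\<dots> = ray_deriv (Suc j) u \<zeta> t"
    unfolding ray_deriv_def lists_length_Suc_eq sum.cartesian_product
    by (subst sum.reindex) (auto simp: inj_on_def case_prod_unfold intro!: sum.cong)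
  finally show ?thesis .
qed

lemma ray_in_ball: "norm \<zeta> = 1 \<Longrightarrow> \<bar>t\<bar> < 1 \<Longrightarrow> t *\<^sub>R \<zeta> \<in> ball 0 1"
  by simp

text \<open>Each k-th partial derivative extends continuously to the compact closed ball and is
  therefore bounded; the ray derivative is a fixed finite linear combination of them.\<close>

lemma ray_deriv_bounded:
  fixes u :: "'a::euclidean_space \<Rightarrow> 'b::real_normed_vector"
  assumes u: "Ck_closure k (ball 0 1) u" and \<zeta>: "norm \<zeta> = 1"
  obtains M where "\<And>t. \<bar>t\<bar> < 1 \<Longrightarrow> norm (ray_deriv k u \<zeta> t) \<le> M"
proof -
  have "\<exists>B. \<forall>x\<in>ball 0 1. norm (iter_pd ds u x) \<le> B" if ds: "set ds \<subseteq> Basis" "length ds = k" for ds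
  proof -
    obtain g where g: "continuous_on (closure (ball 0 1)) g" "\<forall>x\<in>ball 0 1. g x = iter_pd ds u x"
      using u ds unfolding Ck_closure_def by blast
    have "bounded (g ` closure (ball 0 1))"
      using compact_imp_bounded[OF compact_continuous_image[OF g(1)]] by simp
    then obtain B where "\<forall>y\<in>g ` closure (ball 0 1). norm y \<le> B" unfolding bounded_iff by blast
    then have "norm (iter_pd ds u x) \<le> B" if "x \<in> ball 0 1" for x
      using g(2) that closure_subset by (metis imageI subsetD)
    then show ?thesis by blast
  qed
  then obtain B where B: "\<And>ds x. set ds \<subseteq> Basis \<Longrightarrow> length ds = k \<Longrightarrow> x \<in> ball 0 1 \<Longrightarrow> norm (iter_pd ds u x) \<le> B ds"
    by metis
  show ?thesis
  proof (rule that)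
    fix t :: real assume "\<bar>t\<bar> < 1"
    then show "norm (ray_deriv k u \<zeta> t) \<le>
        (\<Sum>ds\<in>{ds. set ds \<subseteq> Basis \<and> length ds = k}. \<bar>\<Prod>d\<leftarrow>ds. \<zeta> \<bullet> d\<bar> * B ds)"
      unfolding ray_deriv_def using B ray_in_ball[OF \<zeta>]
      by (intro sum_norm_le) (auto intro!: mult_left_mono)
  qed
qed

lemma ray_deriv_holder:
  fixes u :: "'a::euclidean_space \<Rightarrow> 'b::real_normed_vector"
  assumes u: "Ck_holder k \<alpha> (ball 0 1) u" and \<zeta>: "norm \<zeta> = 1"
  obtains C where "\<And>t s. \<bar>t\<bar> < 1 \<Longrightarrow> \<bar>s\<bar> < 1 \<Longrightarrow>
    norm (ray_deriv k u \<zeta> s - ray_deriv k u \<zeta> t) \<le> C * \<bar>s - t\<bar> powr \<alpha>"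
proof -
  have "\<exists>C. \<forall>x\<in>ball 0 1. \<forall>y\<in>ball 0 1. norm (iter_pd ds u x - iter_pd ds u y) \<le> C * dist x y powr \<alpha>"
    if "set ds \<subseteq> Basis" "length ds = k" for ds
    using u that unfolding Ck_holder_def by blast
  then obtain C where C: "\<And>ds x y. set ds \<subseteq> Basis \<Longrightarrow> length ds = k \<Longrightarrow> x \<in> ball 0 1 \<Longrightarrow> y \<in> ball 0 1 \<Longrightarrow>
      norm (iter_pd ds u x - iter_pd ds u y) \<le> C ds * dist x y powr \<alpha>"
    by metis
  show ?thesis
  proof (rule that)
    fix t s :: real assume ts: "\<bar>t\<bar> < 1" "\<bar>s\<bar> < 1"
    have dist: "dist (s *\<^sub>R \<zeta>) (t *\<^sub>R \<zeta>) = \<bar>s - t\<bar>"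
      unfolding dist_norm scaleR_left_diff_distrib[symmetric] using \<zeta> by simp
    show "norm (ray_deriv k u \<zeta> s - ray_deriv k u \<zeta> t) \<le>
        (\<Sum>ds\<in>{ds. set ds \<subseteq> Basis \<and> length ds = k}. \<bar>\<Prod>d\<leftarrow>ds. \<zeta> \<bullet> d\<bar> * C ds) * \<bar>s - t\<bar> powr \<alpha>"
      unfolding ray_deriv_def sum_subtractf[symmetric] scaleR_diff_right[symmetric] sum_distrib_right
    proof (intro sum_norm_le)
      fix ds assume "ds \<in> {ds. set ds \<subseteq> (Basis::'a set) \<and> length ds = k}"
      then have "norm (iter_pd ds u (s *\<^sub>R \<zeta>) - iter_pd ds u (t *\<^sub>R \<zeta>)) \<le> C ds * \<bar>s - t\<bar> powr \<alpha>"
        using C[of ds "s *\<^sub>R \<zeta>" "t *\<^sub>R \<zeta>"] ts unfolding dist by (simp add: \<zeta>)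
      from mult_left_mono[OF this, of "\<bar>\<Prod>d\<leftarrow>ds. \<zeta> \<bullet> d\<bar>"]
      show "norm ((\<Prod>d\<leftarrow>ds. \<zeta> \<bullet> d) *\<^sub>R (iter_pd ds u (s *\<^sub>R \<zeta>) - iter_pd ds u (t *\<^sub>R \<zeta>)))
          \<le> \<bar>\<Prod>d\<leftarrow>ds. \<zeta> \<bullet> d\<bar> * C ds * \<bar>s - t\<bar> powr \<alpha>"
        by (simp add: mult.assoc)
    qed
  qed
qed

lemma ray_deriv_eq_powser:
  fixes u :: "'a::euclidean_space \<Rightarrow> complex"
  assumes u: "Ck_on k (ball 0 1) u" and \<zeta>: "norm \<zeta> = 1"
    and eq: "\<And>t. \<bar>t\<bar> < 1 \<Longrightarrow> u (t *\<^sub>R \<zeta>) = \<kappa> * of_real (powser e t)"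
    and sm: "\<And>t. \<bar>t\<bar> < 1 \<Longrightarrow> summable (\<lambda>j. e j * t ^ j)"
    and "j \<le> k" "\<bar>t\<bar> < 1"
  shows "ray_deriv j u \<zeta> t = \<kappa> * of_real (powser ((diffs ^^ j) e) t)"
  using assms(5,6)
proof (induction j arbitrary: t)
  case 0
  then show ?case by (simp add: ray_deriv_0 eq)
next
  case (Suc j)
  have "(ray_deriv j u \<zeta> has_vector_derivative ray_deriv (Suc j) u \<zeta> t) (at t)"
    using Suc.prems by (intro ray_deriv_has_vector_derivative[OF u] ray_in_ball \<zeta>) auto
  moreover have "((\<lambda>t. \<kappa> * of_real (powser ((diffs ^^ j) e) t)) has_vector_derivative
      \<kappa> * of_real (powser ((diffs ^^ Suc j) e) t)) (at t)"
    using powser_has_derivative[OF summable_diffs_funpow[OF sm] Suc.prems(2), of j]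
    by (intro bounded_linear.has_vector_derivative[OF bounded_linear_mult_right]
        bounded_linear.has_vector_derivative[OF bounded_linear_of_real])
      (simp_all add: has_real_derivative_iff_has_vector_derivative)
  then have "(ray_deriv j u \<zeta> has_vector_derivative \<kappa> * of_real (powser ((diffs ^^ Suc j) e) t)) (at t)"
    by (rule has_vector_derivative_transform_within_open[where S = "{-1<..<1}"])
      (use Suc in \<open>auto simp: abs_less_iff\<close>)
  ultimately show ?case by (rule vector_derivative_unique_at)
qed

section \<open>Identification of u with the explicit solution, and the conclusion\<close>

lemma twice_differentiable_add_scaled:
  assumes f: "twice_differentiable_on f U" and g: "twice_differentiable_on g U" and U: "open U"
  shows "twice_differentiable_on (\<lambda>z. f z + c * g z) U"
    and "z \<in> U \<Longrightarrow> inv_lap (\<lambda>z. f z + c * g z) z = inv_lap f z + c * inv_lap g z"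
proof -
  have d: "f differentiable (at z)" "g differentiable (at z)"
    and d2: "dz j f differentiable (at z)" "dzbar j f differentiable (at z)"
      "dz j g differentiable (at z)" "dzbar j g differentiable (at z)" if "z \<in> U" for z j
    using f g that unfolding twice_differentiable_on_def by blast+
  note dd = dz_add_scaled[OF d]
  have "(\<lambda>z. f z + c * g z) differentiable (at z)" if "z \<in> U" for z
    using d[OF that] by (auto intro!: derivative_intros)
  moreover have "dz j (\<lambda>z. f z + c * g z) differentiable (at z)" if "z \<in> U" for j z
    by (rule differentiable_cong_open[OF U that dd(1)]) (use d2[OF that] in \<open>auto intro!: derivative_intros\<close>)
  moreover have "dzbar j (\<lambda>z. f z + c * g z) differentiable (at z)" if "z \<in> U" for j z
    by (rule differentiable_cong_open[OF U that dd(2)]) (use d2[OF that] in \<open>auto intro!: derivative_intros\<close>)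
  ultimately show "twice_differentiable_on (\<lambda>z. f z + c * g z) U"
    unfolding twice_differentiable_on_def by blast
  assume z: "z \<in> U"
  have "dz j (dzbar k (\<lambda>z. f z + c * g z)) z = dz j (dzbar k f) z + c * dz j (dzbar k g) z" for j k
    using dz_cong(1)[OF U z dd(2)] dz_add_scaled(1)[OF d2(2,4)[OF z]] by simp
  then show "inv_lap (\<lambda>z. f z + c * g z) z = inv_lap f z + c * inv_lap g z"
    unfolding inv_lap_def by (simp add: distrib_left sum.distrib sum_distrib_left mult.left_commute)
qed

text \<open>With nonnegative summable coefficients, the coefficients themselves are a Weierstrass
  majorant on the closed interval. The endpoint 1 matters: it carries the boundary values of the
  explicit solution.\<close>

lemma continuous_on_powser:
  assumes "summable d" "\<And>j. d j \<ge> 0"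
  shows "continuous_on {-1..1} (powser d)"
  unfolding powser_def[abs_def]
proof (rule uniform_limit_theorem)
  show "uniform_limit {-1..1} (\<lambda>n t. \<Sum>j<n. d j * t ^ j) (\<lambda>t. \<Sum>j. d j * t ^ j) sequentially"
  proof (rule Weierstrass_m_test[OF _ assms(1)])
    show "norm (d j * t ^ j) \<le> d j" if "t \<in> {-1..1}" for j t
      using assms(2) that by (simp add: abs_mult power_abs mult_left_le power_le_one abs_le_iff)
  qed
qed (auto intro!: always_eventually continuous_intros)

lemma solution_along_ray:
  fixes p q :: nat
    and a :: "('n::finite \<Rightarrow> nat) \<Rightarrow> ('n \<Rightarrow> nat) \<Rightarrow> complex"
    and u :: "complex ^ 'n \<Rightarrow> complex"
  assumes pq: "p > 0" "q > 0"
    and nonzero: "\<exists>z. bihom_poly p q a z \<noteq> 0"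
    and harmonic: "\<forall>z\<in>ball 0 1. lap (bihom_poly p q a) z = 0"
    and u_C2: "Ck_on 2 (ball 0 1) u"
    and u_inv_harm: "\<forall>z\<in>ball 0 1. inv_lap u z = 0"
    and u_cont: "continuous_on (cball 0 1) u"
    and u_bdry: "\<forall>z\<in>sphere 0 1. u z = bihom_poly p q a z"
  obtains \<zeta> \<kappa> where "norm \<zeta> = 1" "\<kappa> \<noteq> 0"
    "\<And>t. \<bar>t\<bar> < 1 \<Longrightarrow> u (t *\<^sub>R \<zeta>) = \<kappa> * of_real (powser (spread (p + q)
        (hyp_coeff (real p / 2) (real q / 2) ((1 + real CARD('n) + real p + real q) / 2))) t)"
proof -
  define A B C where "A = real p / 2" "B = real q / 2" "C = (1 + real CARD('n) + real p + real q) / 2"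
  define f where "f = bihom_poly p q a"
  define h where "h = hyp_coeff A B C"
  have ABC: "A > 0" "B > 0" "C - A - B > 0" "C > 0" using pq unfolding A_B_C_def by (auto simp: field_simps)
  have smh: "summable h" unfolding h_def by (rule summable_hyp_coeff[OF ABC(1,2,4,3)])
  have hpos: "h j > 0" for j unfolding h_def by (rule hyp_coeff_pos[OF ABC(1,2,4)])
  have smt: "summable (\<lambda>j. h j * t ^ j)" if "\<bar>t\<bar> \<le> 1" for t
    unfolding h_def by (rule summable_hyp_powser[OF ABC(1-3) that])
  define F where "F = powser h"
  have F1: "F 1 > 0" unfolding F_def powser_def using suminf_pos[OF smh hpos] by simp
  have dF: "(F has_real_derivative powser (diffs h) s) (at s)"
    "(powser (diffs h) has_real_derivative powser (diffs (diffs h)) s) (at s)" if "\<bar>s\<bar> < 1" for s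
    unfolding F_def using that by (auto intro!: powser_has_derivative summable_diffs smt)
  define \<phi>1 where "\<phi>1 = (\<lambda>r. powser (diffs h) (r\<^sup>2) * (2 * r))"
  define \<phi>2 where "\<phi>2 = (\<lambda>r. powser (diffs (diffs h)) (r\<^sup>2) * (2 * r) * (2 * r) + powser (diffs h) (r\<^sup>2) * 2)"
  have \<phi>1: "((\<lambda>r. F (r\<^sup>2)) has_real_derivative \<phi>1 r) (at r)"
    and \<phi>2: "(\<phi>1 has_real_derivative \<phi>2 r) (at r)" if "\<bar>r\<bar> < 1" for r
  proof -
    have r: "\<bar>r\<^sup>2\<bar> < 1" using that by (simp add: abs_square_less_1)
    have sq: "((\<lambda>r. r\<^sup>2) has_real_derivative 2 * r) (at r)" by (auto intro!: derivative_eq_intros)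
    show "((\<lambda>r. F (r\<^sup>2)) has_real_derivative \<phi>1 r) (at r)"
      unfolding \<phi>1_def by (rule DERIV_chain2[OF dF(1)[OF r] sq])
    show "(\<phi>1 has_real_derivative \<phi>2 r) (at r)"
      unfolding \<phi>1_def \<phi>2_def
      by (rule derivative_eq_intros DERIV_chain2[OF dF(2)[OF r] sq] refl | simp)+
  qed
  define v where "v = (\<lambda>z. f z * of_real (F (((norm z)\<^sup>2)\<^sup>2)))"
  note rad = radial_times_bihom_poly[where \<phi> = "\<lambda>r. F (r\<^sup>2)" and p = p and q = q and a = a, folded f_def, OF \<phi>1 \<phi>2, folded v_def]
  have v0: "inv_lap v z = 0" if z: "z \<in> ball 0 1" for z
  proof -
    define r where "r = (norm z)\<^sup>2"
    have "norm z < 1" using z by simp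
    then have r: "\<bar>r\<bar> < 1" unfolding r_def by (simp add: abs_square_less_1)
    then have r2: "\<bar>r\<^sup>2\<bar> < 1" by (simp add: abs_square_less_1)
    define g0 g1 g2 where "g0 = F (r\<^sup>2)" "g1 = powser (diffs h) (r\<^sup>2)" "g2 = powser (diffs (diffs h)) (r\<^sup>2)"
    have "r\<^sup>2 * (1 - r\<^sup>2) * g2 + (C - (A + B + 1) * r\<^sup>2) * g1 - A * B * g0 = 0"
      using hypergeometric_ode[OF ABC(1-3) r2] unfolding g0_g1_g2_def F_def h_def .
    \<comment> \<open>Under s = r^2 one has \<phi>' = 2 r F' and \<phi>'' = 4 r^2 F'' + 2 F', and
      the radial equation becomes 4 r times the hypergeometric one. Matching the coefficients of
      F'', F' and F gives a + b + 1 = (p+q)/2 + 1, a b = p q / 4 and c = (1+n+p+q)/2.\<close>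
    then have "4 * r * (r\<^sup>2 * (1 - r\<^sup>2) * g2 + (C - (A + B + 1) * r\<^sup>2) * g1 - A * B * g0) = 0" by simp
    also have "4 * r * (r\<^sup>2 * (1 - r\<^sup>2) * g2 + (C - (A + B + 1) * r\<^sup>2) * g1 - A * B * g0) =
      r * \<phi>2 r + (real CARD('n) + real p + real q) * \<phi>1 r
        - r * (r\<^sup>2 * \<phi>2 r + (1 + real p + real q) * r * \<phi>1 r + real p * real q * g0)"
      unfolding \<phi>1_def \<phi>2_def g0_g1_g2_def[symmetric] A_B_C_def
      by (simp add: field_simps power2_eq_square)
    finally show ?thesis
      using rad(2)[OF _ _ z _ r_def] harmonic z unfolding f_def[symmetric] g0_g1_g2_def by simp
  qed
  \<comment> \<open>On the sphere \<open>v\<close> equals \<open>F 1 * f\<close>, so dividing by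
    \<open>F 1\<close>, positive because all coefficients are, matches the boundary values of
    \<open>u\<close>.\<close>
  define w where "w = (\<lambda>z. u z + (- 1 / of_real (F 1)) * v z)"
  have w2: "twice_differentiable_on w (ball 0 1)"
    unfolding w_def by (intro twice_differentiable_add_scaled Ck_on_2_twice_differentiable u_C2 rad(1) open_ball)
  have w0: "inv_lap w z = 0" if "z \<in> ball 0 1" for z
  proof -
    have "inv_lap w z = inv_lap u z + (- 1 / of_real (F 1)) * inv_lap v z"
      unfolding w_def
      by (rule twice_differentiable_add_scaled(2)[OF Ck_on_2_twice_differentiable[OF u_C2] rad(1) open_ball that])
    then show ?thesis using v0[OF that] u_inv_harm that by simp
  qed
  have "f differentiable_on UNIV"
    using twice_differentiable_bihom_poly[of p q a UNIV] unfolding f_def twice_differentiable_on_def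
    by (auto simp: differentiable_on_def differentiable_at_withinI)
  then have contf: "continuous_on (cball 0 1) f"
    using differentiable_imp_continuous_on continuous_on_subset by blast
  have contF: "continuous_on (cball 0 1) (\<lambda>z :: complex ^ 'n. F (((norm z)\<^sup>2)\<^sup>2))"
  proof (rule continuous_on_compose2[OF continuous_on_powser[OF smh less_imp_le[OF hpos], folded F_def]])
    show "(\<lambda>z :: complex ^ 'n. ((norm z)\<^sup>2)\<^sup>2) ` cball 0 1 \<subseteq> {-1..1}"
    proof clarify
      fix x :: "complex ^ 'n" assume "x \<in> cball 0 1"
      then have "((norm x)\<^sup>2)\<^sup>2 \<le> 1" by (simp add: power_le_one)
      moreover have "0 \<le> ((norm x)\<^sup>2)\<^sup>2" by (rule zero_le_power2)
      ultimately show "((norm x)\<^sup>2)\<^sup>2 \<in> {- 1..1}" unfolding atLeastAtMost_iff by linarith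
    qed
  qed (intro continuous_intros)
  have wc: "continuous_on (cball 0 1) w"
    unfolding w_def v_def by (intro continuous_intros u_cont contf contF)
  have wb: "w z = 0" if "z \<in> sphere 0 1" for z
    using u_bdry that F1 unfolding w_def v_def f_def by simp
  have u_eq: "u z = f z * of_real (F (((norm z)\<^sup>2)\<^sup>2)) / of_real (F 1)" if "z \<in> ball 0 1" for z
    using inv_lap_uniqueness[OF w2 wc w0 wb that] unfolding w_def v_def by simp
  obtain z where z: "f z \<noteq> 0" using nonzero unfolding f_def by blast
  have hom: "f (t *\<^sub>R x) = of_real (t ^ (p + q)) * f x" for t x
    unfolding f_def by (rule bihom_poly_scaleR)
  \<comment> \<open>A form of positive degree p + q vanishes at the origin, so the point can be
    normalised to the sphere without losing \<open>f \<zeta> \<noteq> 0\<close>.\<close>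
  have "z \<noteq> 0" using hom[of 0 z] z pq by (auto simp: power_0_left)
  define \<zeta> where "\<zeta> = (1 / norm z) *\<^sub>R z"
  have \<zeta>: "norm \<zeta> = 1" using \<open>z \<noteq> 0\<close> unfolding \<zeta>_def by simp
  have f\<zeta>: "f \<zeta> \<noteq> 0" using hom[of "1 / norm z" z] z \<open>z \<noteq> 0\<close> unfolding \<zeta>_def by simp
  show ?thesis
  proof (rule that[OF \<zeta>])
    show "f \<zeta> / of_real (F 1) \<noteq> 0" using f\<zeta> F1 by simp
    fix t :: real assume t: "\<bar>t\<bar> < 1"
    have "\<bar>t ^ 4\<bar> \<le> 1" using power_le_one[of "\<bar>t\<bar>" 4] t by simp
    then have S: "powser (spread (p + q) h) t = t ^ (p + q) * F (t ^ 4)"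
      using sums_unique[OF spread_sums[OF summable_sums[OF smt]]] unfolding powser_def F_def by simp
    have "((norm (t *\<^sub>R \<zeta>))\<^sup>2)\<^sup>2 = t ^ 4" using \<zeta> by (simp add: power_mult[symmetric])
    then show "u (t *\<^sub>R \<zeta>) = f \<zeta> / of_real (F 1) * of_real (powser (spread (p + q)
        (hyp_coeff (real p / 2) (real q / 2) ((1 + real CARD('n) + real p + real q) / 2))) t)"
      unfolding u_eq[OF ray_in_ball[OF \<zeta> t]] A_B_C_def[symmetric] h_def[symmetric] S hom by simp
  qed
qed

theorem theorem3p1:
  fixes p q :: nat
    and a :: "('n::finite \<Rightarrow> nat) \<Rightarrow> ('n \<Rightarrow> nat) \<Rightarrow> complex"
    and u :: "complex ^ 'n \<Rightarrow> complex"
  assumes n_gt1: "CARD('n) > 1"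
    and nonzero: "\<exists>z. bihom_poly p q a z \<noteq> 0"
    and harmonic: "\<forall>z\<in>ball 0 1. lap (bihom_poly p q a) z = 0"
    and u_C2: "Ck_on 2 (ball 0 1) u"
    and u_inv_harm: "\<forall>z\<in>ball 0 1. inv_lap u z = 0"
    and u_cont: "continuous_on (cball 0 1) u"
    and u_bdry: "\<forall>z\<in>sphere 0 1. u z = bihom_poly p q a z"
  shows "(odd CARD('n) \<and> Ck_closure ((CARD('n) + 1) div 2) (ball 0 1) u \<longrightarrow> p * q = 0) \<and>
         (even CARD('n) \<and> (\<exists>\<alpha>::real. \<alpha> > 1/2 \<and> Ck_holder (CARD('n) div 2) \<alpha> (ball 0 1) u)
            \<longrightarrow> p * q = 0)"
proof (cases "p * q = 0")
  case False
  then have pq: "p > 0" "q > 0" by auto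
  define A B C where "A = real p / 2" "B = real q / 2" "C = (1 + real CARD('n) + real p + real q) / 2"
  have ABC: "A > 0" "B > 0" "C - A - B > 0" using pq unfolding A_B_C_def by (auto simp: field_simps)
  have CAB: "C - A - B = (real CARD('n) + 1) / 2" unfolding A_B_C_def by (simp add: field_simps)
  define e where "e = spread (p + q) (hyp_coeff A B C)"
  obtain \<zeta> \<kappa> where \<zeta>: "norm \<zeta> = 1" and \<kappa>: "\<kappa> \<noteq> 0"
    and ray: "\<And>t. \<bar>t\<bar> < 1 \<Longrightarrow> u (t *\<^sub>R \<zeta>) = \<kappa> * of_real (powser e t)"
    using solution_along_ray[OF pq nonzero harmonic u_C2 u_inv_harm u_cont u_bdry]
    unfolding e_def A_B_C_def by metis
  have sm: "summable (\<lambda>j. e j * t ^ j)" if "\<bar>t\<bar> < 1" for t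
    unfolding e_def by (rule summable_spread[OF ABC that])
  have deriv: "ray_deriv m u \<zeta> t = \<kappa> * of_real (powser ((diffs ^^ m) e) t)"
    if "Ck_on m (ball 0 1) u" "\<bar>t\<bar> < 1" for m t
    by (rule ray_deriv_eq_powser[OF that(1) \<zeta> ray sm order_refl that(2)])
  have "\<not> Ck_closure ((CARD('n) + 1) div 2) (ball 0 1) u" if "odd CARD('n)"
  proof
    define m where "m = (CARD('n) + 1) div 2"
    assume u: "Ck_closure ((CARD('n) + 1) div 2) (ball 0 1) u"
    then obtain M where M: "\<And>t. \<bar>t\<bar> < 1 \<Longrightarrow> norm (ray_deriv m u \<zeta> t) \<le> M"
      using ray_deriv_bounded[OF _ \<zeta>] unfolding m_def by metis
    \<comment> \<open>For odd n the order m = (n+1)/2 uses up the whole exponent; the remainder e =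
      0 is the logarithmic case.\<close>
    have "C - A - B = real m" unfolding CAB m_def using that by (auto elim!: oddE)
    then obtain t where t: "0 \<le> t" "t < 1" "powser ((diffs ^^ m) e) t > M / norm \<kappa>"
      using powser_diffs_spread_unbounded[OF ABC] unfolding e_def by blast
    have "norm (ray_deriv m u \<zeta> t) = norm \<kappa> * \<bar>powser ((diffs ^^ m) e) t\<bar>"
      using deriv[of m t] u t unfolding Ck_closure_def m_def by (simp add: norm_mult)
    then have "norm \<kappa> * \<bar>powser ((diffs ^^ m) e) t\<bar> \<le> M" using M[of t] t by simp
    then have "\<bar>powser ((diffs ^^ m) e) t\<bar> \<le> M / norm \<kappa>"
      using \<kappa> by (simp add: field_simps)
    then show False using t(3) by linarith
  qed
  moreover have "\<not> Ck_holder (CARD('n) div 2) \<alpha> (ball 0 1) u"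
    if even: "even CARD('n)" and \<alpha>: "\<alpha> > 1 / 2" for \<alpha> :: real
  proof
    define m where "m = CARD('n) div 2"
    assume u: "Ck_holder (CARD('n) div 2) \<alpha> (ball 0 1) u"
    then obtain K where K: "\<And>t s. \<bar>t\<bar> < 1 \<Longrightarrow> \<bar>s\<bar> < 1 \<Longrightarrow>
        norm (ray_deriv m u \<zeta> s - ray_deriv m u \<zeta> t) \<le> K * \<bar>s - t\<bar> powr \<alpha>"
      using ray_deriv_holder[OF _ \<zeta>] unfolding m_def by metis
    \<comment> \<open>For even n the order m = n/2 leaves the remainder 1/2, the critical Hoelder
      exponent.\<close>
    have "C - A - B = real m + 1 / 2" unfolding CAB m_def using even by (simp add: real_of_nat_div field_simps)
    then obtain t s where t: "0 \<le> t" "t < s" "s < 1"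
      "powser ((diffs ^^ m) e) s - powser ((diffs ^^ m) e) t > K / norm \<kappa> * (s - t) powr \<alpha>"
      using powser_diffs_spread_not_holder[OF ABC _ \<alpha>] unfolding e_def by blast
    have "ray_deriv m u \<zeta> s - ray_deriv m u \<zeta> t =
        \<kappa> * of_real (powser ((diffs ^^ m) e) s - powser ((diffs ^^ m) e) t)"
      using deriv[of m] u t unfolding Ck_holder_def Ck_closure_def m_def by (simp add: right_diff_distrib)
    then have "norm \<kappa> * \<bar>powser ((diffs ^^ m) e) s - powser ((diffs ^^ m) e) t\<bar> \<le> K * (s - t) powr \<alpha>"
      using K[of t s] t by (simp add: norm_mult del: of_real_diff)
    \<comment> \<open>Dividing by |\<kappa>| passes from \<open>u\<close> to the real power series,
      which explains the constant \<open>K / norm \<kappa>\<close> chosen when \<open>t\<close> and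
      \<open>s\<close> were obtained.\<close>
    then have "\<bar>powser ((diffs ^^ m) e) s - powser ((diffs ^^ m) e) t\<bar> \<le> K / norm \<kappa> * (s - t) powr \<alpha>"
      using \<kappa> by (simp add: field_simps)
    then show False using t(4) by linarith
  qed
  ultimately show ?thesis by blast
qed simp

end
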